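(* Let $k\ge2$ and let $\{X_n\}_{n\ge0}$ be a sequence of random variables with $X_{n+1}=\boldsymbol{\alpha}_n\cdot\mathbf{X}_n+Z_n$, $n\ge0$, where $\boldsymbol{\alpha}_n=(\alpha_{n,1},\ldots,\alpha_{n,k})^{\mathsf T}\in\mathbb{R}^k$ with $\lambda_n=\|\boldsymbol{\alpha}_n\|\ne0$ (Euclidean norm), $\mathbf{X}_n=(X_{n,1},\ldots,X_{n,k})^{\mathsf T}$ is a vector in $\mathbb{R}^k$ with i.i.d. components distributed as $X_n$, with mean $c_n$ and nonzero variance $\sigma_n^2$, and $Z_n$ is a random variable. Set $$W_n=\frac{X_n-c_n}{\sigma_n},\qquad W_{n,i}=\frac{X_{n,i}-c_n}{\sigma_n},\qquad Y_n=\sum_{i=1}^k\frac{\alpha_{n,i}}{\lambda_n}W_{n,i},$$ $$\beta_n=E|W_{n+1}-Y_n|+\tfrac12E|W_{n+1}^3-Y_n^3|,\qquad \varphi_n=\frac{\sum_{i=1}^k|\alpha_{n,i}|^3}{\lambda_n^3},$$ where in $\beta_n$ the variable $W_{n+1}$ is $(\boldsymbol{\alpha}_n\cdot\mathbf{X}_n+Z_n-c_{n+1})/\sigma_{n+1}$, defined on the same space as $Y_n$. Let $\mathcal{N}$ be a standard normal variable and $d$ the Wasserstein distance. (i) If there exist $(\beta,\varphi)\in(0,1)^2$ such that $$\limsup_{n\to\infty}\frac{\beta_n}{\beta^n}<\infty\quad\text{and}\quad\limsup_{n\to\infty}\varphi_n=\varphi,$$ then with $\gamma=\beta$ when $\varphi<\beta$,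 and for any $\gamma\in(\varphi,1)$ when $\beta\le\varphi$, there exists $C$ such that for all $n$ $$d(W_n,\mathcal{N})\le C\gamma^n.\qquad( * )$$ (ii) Suppose that both of the following moment conditions A and B hold. Condition A: the nonzero sequence of vectors $\boldsymbol{\alpha}_n\in\mathbb{R}^k$ converges to $\boldsymbol{\alpha}=(\alpha_1,\ldots,\alpha_k)^{\mathsf T}$, not equal to any multiple of a standard basis vector, and, for $\lambda=\|\boldsymbol{\alpha}\|$, there exist $0<\delta_1<\delta_2<1$ and constants $C_{Z,2},C_{X,2}$ such that for all $n$ $$\mathrm{Var}(Z_n)\le C_{Z,2}^2\lambda^{2n}(1-\delta_2)^{2n},\qquad \mathrm{Var}(X_n)\ge C_{X,2}^2\lambda^{2n}(1-\delta_1)^{2n}.$$ Condition B: there exist $\delta_3$ and $\delta_4\in(\delta_1,1)$ and constants $C_{Z,4},C_{X,4}$ such that for all $n$ $$E(Z_n-EZ_n)^4\le C_{Z,4}^4\lambda^{4n}(1-\delta_4)^{4n},\qquad E(X_n-EX_n)^4\le C_{X,4}^4\lambda^{4n}(1+\delta_3)^{4n},$$ and $$\beta=\max\{\phi_1,\phi_2\}<1,\quad\text{where }\ \phi_1=\frac{(1-\delta_2)(1+\delta_3)^3}{(1-\delta_1)^4}\ \text{ and }\ \phi_2=\left(\frac{1-\delta_4}{1-\delta_1}\right)^2.$$ Then, with this $\beta$ and $\varphi=\sum_{i=1}^k|\alpha_i|^3/\lambda^3$, one has $\varphi<1$ and for all $\gamma\in(\max(\beta,\varphi),1)$ there exists $C$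 such that $( * )$ holds for all $n$.
   Context: Wasserstein distance: $d(Y,X)=\sup_{h\in\mathcal{L}}|E(h(Y)-h(X))|$, where $\mathcal{L}=\{h:\mathbb{R}\to\mathbb{R}: |h(y)-h(x)|\le|y-x| \text{ for all } x,y\}$.
   Formalization: Part (i) additionally assumes that E|X_n|^3 is finite for all n; in part (ii) the constant C_{X,2} is taken positive and δ_3 > -1. Without these assumptions the claims fail. *)

theory Defs
  imports "HOL-Probability.Probability"
begin

text \<open>The Wasserstein distance between a random variable \<open>Y\<close> on \<open>M\<close> and a random variable \<open>X\<close> on
  \<open>N\<close>. As it depends on the two laws only, the variables need not share a space: for integrable
  \<open>X\<close> and \<open>Y\<close> every \<open>h(Y)\<close> and \<open>h(X)\<close> is integrable, and \<open>E(h(Y) - h(X)) = E h(Y) - E h(X)\<close>.\<close>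

definition wasserstein :: "'a measure \<Rightarrow> ('a \<Rightarrow> real) \<Rightarrow> 'b measure \<Rightarrow> ('b \<Rightarrow> real) \<Rightarrow> ereal" where
  "wasserstein M Y N X =
     (SUP h \<in> {h :: real \<Rightarrow> real. \<forall>x y. \<bar>h y - h x\<bar> \<le> \<bar>y - x\<bar>}.
        ereal \<bar>(\<integral>\<omega>. h (Y \<omega>) \<partial>M) - (\<integral>\<omega>. h (X \<omega>) \<partial>N)\<bar>)"

definition std_dev :: "'a measure \<Rightarrow> ('a \<Rightarrow> real) \<Rightarrow> real" where
  "std_dev M X = sqrt (prob_space.variance M X)"

text \<open>Extended-valued, so that an upper bound on it entails that the fourth moment is finite.\<close>

definition fourth_central_moment :: "'a measure \<Rightarrow> ('a \<Rightarrow> real) \<Rightarrow> ennreal" where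
  "fourth_central_moment M X =
     (\<integral>\<^sup>+\<omega>. ennreal ((X \<omega> - prob_space.expectation M X) ^ 4) \<partial>M)"

text \<open>The \<open>n\<close>-th step of the recursion lives on a probability space \<open>M n\<close> of its own, carrying
  \<open>X n\<close>, the vector \<open>V n\<close> of independent copies of \<open>X n\<close>, and \<open>Z n\<close>; no relation between
  \<open>Z n\<close> and \<open>V n\<close> is imposed. The identity \<open>X\<^sub>n\<^sub>+\<^sub>1 = \<alpha>\<^sub>n \<cdot> V\<^sub>n + Z\<^sub>n\<close> is one of laws;
  the case of a single space with pointwise identities is that of a constant \<open>M\<close>.\<close>

definition hierarchical_sequence ::
  "(nat \<Rightarrow> real ^ 'k) \<Rightarrow> (nat \<Rightarrow> 'a measure) \<Rightarrow> (nat \<Rightarrow> 'a \<Rightarrow> real) \<Rightarrow>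
    (nat \<Rightarrow> 'a \<Rightarrow> real ^ 'k) \<Rightarrow> (nat \<Rightarrow> 'a \<Rightarrow> real) \<Rightarrow> bool" where
  "hierarchical_sequence \<alpha> M X V Z \<longleftrightarrow>
     (\<forall>n.
        prob_space (M n) \<and>
        norm (\<alpha> n) \<noteq> 0 \<and>
        X n \<in> borel_measurable (M n) \<and>
        Z n \<in> borel_measurable (M n) \<and>
        integrable (M n) (\<lambda>\<omega>. (X n \<omega>)\<^sup>2) \<and>
        prob_space.variance (M n) (X n) \<noteq> 0 \<and>
        prob_space.indep_vars (M n) (\<lambda>_. borel) (\<lambda>i \<omega>. V n \<omega> $ i) UNIV \<and>
        (\<forall>i. distr (M n) borel (\<lambda>\<omega>. V n \<omega> $ i) = distr (M n) borel (X n)) \<and>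
        distr (M (Suc n)) borel (X (Suc n)) = distr (M n) borel (\<lambda>\<omega>. \<alpha> n \<bullet> V n \<omega> + Z n \<omega>))"

definition W_seq :: "(nat \<Rightarrow> 'a measure) \<Rightarrow> (nat \<Rightarrow> 'a \<Rightarrow> real) \<Rightarrow> nat \<Rightarrow> 'a \<Rightarrow> real" where
  "W_seq M X n \<omega> = (X n \<omega> - prob_space.expectation (M n) (X n)) / std_dev (M n) (X n)"

text \<open>\<open>Y\<^sub>n\<close>, and the version of \<open>W\<^sub>n\<^sub>+\<^sub>1\<close> living on the same space \<open>M n\<close>.\<close>

definition Y_seq ::
  "(nat \<Rightarrow> real ^ 'k) \<Rightarrow> (nat \<Rightarrow> 'a measure) \<Rightarrow> (nat \<Rightarrow> 'a \<Rightarrow> real) \<Rightarrow>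
    (nat \<Rightarrow> 'a \<Rightarrow> real ^ 'k) \<Rightarrow> nat \<Rightarrow> 'a \<Rightarrow> real" where
  "Y_seq \<alpha> M X V n \<omega> =
     (\<Sum>i\<in>UNIV. \<alpha> n $ i / norm (\<alpha> n) *
        ((V n \<omega> $ i - prob_space.expectation (M n) (X n)) / std_dev (M n) (X n)))"

definition W_next ::
  "(nat \<Rightarrow> real ^ 'k) \<Rightarrow> (nat \<Rightarrow> 'a measure) \<Rightarrow> (nat \<Rightarrow> 'a \<Rightarrow> real) \<Rightarrow>
    (nat \<Rightarrow> 'a \<Rightarrow> real ^ 'k) \<Rightarrow> (nat \<Rightarrow> 'a \<Rightarrow> real) \<Rightarrow> nat \<Rightarrow> 'a \<Rightarrow> real" where
  "W_next \<alpha> M X V Z n \<omega> =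
     (\<alpha> n \<bullet> V n \<omega> + Z n \<omega> - prob_space.expectation (M (Suc n)) (X (Suc n)))
       / std_dev (M (Suc n)) (X (Suc n))"

text \<open>The integrals are Bochner integrals, which are the intended expectations when the third
  moments of all the \<open>X n\<close> are finite.\<close>

definition beta_seq ::
  "(nat \<Rightarrow> real ^ 'k) \<Rightarrow> (nat \<Rightarrow> 'a measure) \<Rightarrow> (nat \<Rightarrow> 'a \<Rightarrow> real) \<Rightarrow>
    (nat \<Rightarrow> 'a \<Rightarrow> real ^ 'k) \<Rightarrow> (nat \<Rightarrow> 'a \<Rightarrow> real) \<Rightarrow> nat \<Rightarrow> real" where
  "beta_seq \<alpha> M X V Z n =
     (\<integral>\<omega>. \<bar>W_next \<alpha> M X V Z n \<omega> - Y_seq \<alpha> M X V n \<omega>\<bar> \<partial>M n)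
     + 1 / 2 * (\<integral>\<omega>. \<bar>W_next \<alpha> M X V Z n \<omega> ^ 3 - Y_seq \<alpha> M X V n \<omega> ^ 3\<bar> \<partial>M n)"

definition phi_vec :: "real ^ 'k \<Rightarrow> real" where
  "phi_vec v = (\<Sum>i\<in>UNIV. \<bar>v $ i\<bar> ^ 3) / norm v ^ 3"

text \<open>The constant in the lower bound on the variance of \<open>X n\<close> has to be nonzero for that bound
  to say anything; the constants in upper bounds need no sign condition.\<close>

definition condition_A ::
  "(nat \<Rightarrow> real ^ 'k) \<Rightarrow> (nat \<Rightarrow> 'a measure) \<Rightarrow> (nat \<Rightarrow> 'a \<Rightarrow> real) \<Rightarrow> (nat \<Rightarrow> 'a \<Rightarrow> real) \<Rightarrow>
    real ^ 'k \<Rightarrow> real \<Rightarrow> real \<Rightarrow> bool" where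
  "condition_A \<alpha> M X Z a \<delta>\<^sub>1 \<delta>\<^sub>2 \<longleftrightarrow>
     (\<forall>n. \<alpha> n \<noteq> 0) \<and> \<alpha> \<longlonglongrightarrow> a \<and> (\<forall>c i. a \<noteq> c *\<^sub>R axis i 1) \<and>
     0 < \<delta>\<^sub>1 \<and> \<delta>\<^sub>1 < \<delta>\<^sub>2 \<and> \<delta>\<^sub>2 < 1 \<and>
     (\<exists>CZ2 CX2. CX2 > 0 \<and>
        (\<forall>n. prob_space.variance (M n) (Z n)
               \<le> CZ2\<^sup>2 * norm a ^ (2 * n) * (1 - \<delta>\<^sub>2) ^ (2 * n)) \<and>
        (\<forall>n. prob_space.variance (M n) (X n)
               \<ge> CX2\<^sup>2 * norm a ^ (2 * n) * (1 - \<delta>\<^sub>1) ^ (2 * n)))"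

definition rate_B :: "real \<Rightarrow> real \<Rightarrow> real \<Rightarrow> real \<Rightarrow> real" where
  "rate_B \<delta>\<^sub>1 \<delta>\<^sub>2 \<delta>\<^sub>3 \<delta>\<^sub>4 =
     max ((1 - \<delta>\<^sub>2) * (1 + \<delta>\<^sub>3) ^ 3 / (1 - \<delta>\<^sub>1) ^ 4) (((1 - \<delta>\<^sub>4) / (1 - \<delta>\<^sub>1))\<^sup>2)"

text \<open>The base \<open>1 + \<delta>\<^sub>3\<close> of the growth rate is positive. For \<open>1 + \<delta>\<^sub>3 < 0\<close> the moment bound, in
  which only even powers of it occur, would be unaffected, while its cube makes the first term of
  \<open>rate_B\<close> negative.\<close>

definition condition_B ::
  "(nat \<Rightarrow> 'a measure) \<Rightarrow> (nat \<Rightarrow> 'a \<Rightarrow> real) \<Rightarrow> (nat \<Rightarrow> 'a \<Rightarrow> real) \<Rightarrow>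
    real ^ 'k \<Rightarrow> real \<Rightarrow> real \<Rightarrow> real \<Rightarrow> real \<Rightarrow> bool" where
  "condition_B M X Z a \<delta>\<^sub>1 \<delta>\<^sub>2 \<delta>\<^sub>3 \<delta>\<^sub>4 \<longleftrightarrow>
     - 1 < \<delta>\<^sub>3 \<and> \<delta>\<^sub>1 < \<delta>\<^sub>4 \<and> \<delta>\<^sub>4 < 1 \<and>
     (\<exists>CZ4 CX4 :: real.
        (\<forall>n. fourth_central_moment (M n) (Z n)
               \<le> ennreal (CZ4 ^ 4 * norm a ^ (4 * n) * (1 - \<delta>\<^sub>4) ^ (4 * n))) \<and>
        (\<forall>n. fourth_central_moment (M n) (X n)
               \<le> ennreal (CX4 ^ 4 * norm a ^ (4 * n) * (1 + \<delta>\<^sub>3) ^ (4 * n)))) \<and>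
     rate_B \<delta>\<^sub>1 \<delta>\<^sub>2 \<delta>\<^sub>3 \<delta>\<^sub>4 < 1"

text \<open>The standard normal variable is the identity on the standard normal law.\<close>

definition normal_rate :: "(nat \<Rightarrow> 'a measure) \<Rightarrow> (nat \<Rightarrow> 'a \<Rightarrow> real) \<Rightarrow> real \<Rightarrow> bool" where
  "normal_rate M X \<gamma> \<longleftrightarrow>
     (\<exists>C. \<forall>n. wasserstein (M n) (W_seq M X n) std_normal_distribution (\<lambda>x. x) \<le> ereal (C * \<gamma> ^ n))"

end

theory Submission
  imports Defs
begin

text \<open>The proof measures the distance of a standardized law \<open>\<mu>\<close> from the normal law by its Stein
discrepancy. Stein's identity \<open>E W H(W) = E h(W)\<close>, for all antiderivatives \<open>H\<close> of \<open>h\<close>, characterizes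
the standard normal law; the discrepancy is the largest value of \<open>\<bar>E h(W) - E W H(W)\<bar>\<close> over the
\<open>1\<close>-Lipschitz functions \<open>h\<close>. Since \<open>E W H(W)\<close> is the expectation of \<open>h\<close> under the zero bias transform
of \<open>\<mu>\<close>, this is the Wasserstein distance between \<open>\<mu>\<close> and that transform, written without constructing
the transform. Three facts about it carry the theorem.

Contraction (\<open>stein_discrepancy_weighted_sum\<close>). Let \<open>Y = \<Sum> a\<^sub>i U\<^sub>i\<close> with independent \<open>U\<^sub>i\<close> of law \<open>\<mu>\<close>
and \<open>\<Sum> a\<^sub>i\<^sup>2 = 1\<close>. Then \<open>E h(Y) - E Y H(Y)\<close> is the sum over \<open>i\<close> of \<open>E (a\<^sub>i\<^sup>2 h(Y) - a\<^sub>i U\<^sub>i H(Y))\<close>. With the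
other summands frozen at \<open>s\<close>, the \<open>i\<close>-th term compares \<open>u \<mapsto> a\<^sub>i\<^sup>2 h(s + a\<^sub>i u)\<close> with its antiderivative
\<open>u \<mapsto> a\<^sub>i H(s + a\<^sub>i u)\<close> under \<open>\<mu>\<close>, and the former has Lipschitz constant \<open>\<bar>a\<^sub>i\<bar>\<^sup>3\<close>. So the discrepancy is
multiplied by at most \<open>\<Sum> \<bar>a\<^sub>i\<bar>\<^sup>3\<close>, which is \<open>\<phi>\<^sub>n\<close> for the weights of \<open>Y\<^sub>n\<close>.

Perturbation (\<open>stein_discrepancy_perturb\<close>). Replacing \<open>Y\<^sub>n\<close> by \<open>W\<^sub>n\<^sub>+\<^sub>1\<close> costs at most \<open>\<beta>\<^sub>n\<close>: its first
part pays for \<open>h\<close>, its second for \<open>x H(x)\<close>, whose derivative is at most \<open>3 x\<^sup>2 / 2\<close> once \<open>h\<close> and \<open>H\<close> are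
normalized to vanish at \<open>0\<close>.

Stein's method (\<open>lipschitz_integral_normal_diff_le\<close>). The Wasserstein distance to the normal law is
at most \<open>8\<close> times the discrepancy, because for smooth \<open>1\<close>-Lipschitz \<open>h\<close> the equation
\<open>f'(x) - x f(x) = h(x) - E h(N)\<close> has a solution with \<open>\<bar>f''\<bar> \<le> 8\<close>. The bound on \<open>f''\<close> is obtained by
comparison with explicit supersolutions of the operator \<open>v \<mapsto> v' - x v\<close>.

Hence the discrepancies \<open>K\<^sub>n\<close> satisfy \<open>K\<^sub>n\<^sub>+\<^sub>1 \<le> \<beta>\<^sub>n + \<phi>\<^sub>n K\<^sub>n\<close>, and a source of order \<open>\<gamma>\<^sup>n\<close> together with
a contraction factor eventually below some number less than \<open>\<gamma>\<close> gives \<open>K\<^sub>n = O(\<gamma>\<^sup>n)\<close>. This is the first part. The rate \<open>\<beta>\<close>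
itself is reached when \<open>\<phi> < \<beta>\<close>, because there is then room for a factor strictly between them.

For the second part write \<open>W\<^sub>n\<^sub>+\<^sub>1 = r Y\<^sub>n + \<zeta>\<close>, where \<open>\<zeta>\<close> is the centred \<open>Z\<^sub>n\<close> divided by \<open>\<sigma>\<^sub>n\<^sub>+\<^sub>1\<close>. Both
\<open>W\<^sub>n\<^sub>+\<^sub>1\<close> and \<open>Y\<^sub>n\<close> have unit variance, so \<open>\<bar>r - 1\<bar>\<close> is at most the standard deviation of \<open>\<zeta>\<close>, and
\<open>W\<^sub>n\<^sub>+\<^sub>1 - Y\<^sub>n\<close> is of that order in \<open>L\<^sup>2\<close>. The Cauchy-Schwarz inequality turns this into a bound on
\<open>\<beta>\<^sub>n\<close> that involves the fourth moments of \<open>W\<^sub>n\<close> and \<open>W\<^sub>n\<^sub>+\<^sub>1\<close> (\<open>cubic_distance_of_small_perturbation\<close>).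
With \<open>q = (1 - \<delta>\<^sub>2) / (1 - \<delta>\<^sub>1)\<close> and \<open>\<rho> = (1 + \<delta>\<^sub>3) / (1 - \<delta>\<^sub>1)\<close> the standard deviation of \<open>\<zeta>\<close> is
\<open>O(q\<^sup>n)\<close> and the square roots of the fourth moments are \<open>O(\<rho>\<^sup>2\<^sup>n)\<close>. A standardized fourth moment is at
least \<open>1\<close>, which forces \<open>\<rho> \<ge> 1\<close>, and so \<open>\<beta>\<^sub>n = O((q \<rho>\<^sup>3)\<^sup>n)\<close>; here \<open>q \<rho>\<^sup>3\<close> is the first of the two
numbers whose maximum is the rate. Finally \<open>\<phi>\<^sub>n\<close> converges to the value at the limit vector, which is
below \<open>1\<close> because that vector has at least two nonzero entries.\<close>

section \<open>Lipschitz functions and their antiderivatives\<close>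

lemma lipschitz_on_borel_measurable:
  fixes h :: "real \<Rightarrow> real"
  assumes "L-lipschitz_on UNIV h"
  shows "h \<in> borel_measurable borel"
  using lipschitz_on_continuous_on [OF assms] by (rule borel_measurable_continuous_onI)

lemma lipschitz_on_realD:
  fixes h :: "real \<Rightarrow> real"
  assumes "L-lipschitz_on UNIV h"
  shows "\<bar>h x - h y\<bar> \<le> L * \<bar>x - y\<bar>" "0 \<le> L"
  using lipschitz_onD [OF assms, of x y] lipschitz_on_nonneg [OF assms] by (auto simp: dist_real_def)

lemma lipschitz_on_if_deriv_bounded:
  fixes h h' :: "real \<Rightarrow> real"
  assumes "\<And>x. (h has_real_derivative h' x) (at x)" "\<And>x. \<bar>h' x\<bar> \<le> L" "0 \<le> L"
  shows "L-lipschitz_on UNIV h"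
proof (rule lipschitz_onI)
  show "dist (h x) (h y) \<le> L * dist x y" for x y
    using field_differentiable_bound [of UNIV h h' L x y] assms by (simp add: dist_real_def)
qed fact

lemma deriv_imp_borel_measurable:
  fixes H h :: "real \<Rightarrow> real"
  assumes "\<And>x. (H has_real_derivative h x) (at x)"
  shows "H \<in> borel_measurable borel"
  by (intro borel_measurable_continuous_onI continuous_at_imp_continuous_on ballI DERIV_isCont [OF assms])

lemma integrable_lipschitz:
  fixes h :: "real \<Rightarrow> real"
  assumes \<mu>: "real_distribution \<mu>" and x: "integrable \<mu> (\<lambda>x. x)" and h: "L-lipschitz_on UNIV h"
  shows "integrable \<mu> h"
proof -
  interpret real_distribution \<mu> by fact
  show ?thesis
  proof (rule Bochner_Integration.integrable_bound)
    show "integrable \<mu> (\<lambda>x. \<bar>h 0\<bar> + L * \<bar>x\<bar>)"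
      using x by simp
    show "h \<in> borel_measurable \<mu>"
      using lipschitz_on_borel_measurable [OF h] by (simp cong: measurable_cong_sets)
    have "\<bar>h x\<bar> \<le> \<bar>h 0\<bar> + L * \<bar>x\<bar>" for x
      using lipschitz_on_realD(1) [OF h, of x 0] by simp
    then show "AE x in \<mu>. norm (h x) \<le> norm (\<bar>h 0\<bar> + L * \<bar>x\<bar>)"
      by (intro always_eventually allI) (smt (verit) real_norm_def)
  qed
qed

lemma (in prob_space) integrable_lipschitz_compose:
  fixes h :: "real \<Rightarrow> real"
  assumes Y: "Y \<in> borel_measurable M" "integrable M Y" and h: "L-lipschitz_on UNIV h"
  shows "integrable M (\<lambda>\<omega>. h (Y \<omega>))"
proof -
  have "integrable (distr M borel Y) h"
  proof (rule integrable_lipschitz [OF real_distribution_distr [OF Y(1)] _ h])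
    show "integrable (distr M borel Y) (\<lambda>x. x)"
      using Y by (simp add: integrable_distr_eq)
  qed
  then show ?thesis
    using lipschitz_on_borel_measurable [OF h] Y(1) by (simp add: integrable_distr_eq)
qed

lemma continuous_antiderivative_exists:
  fixes k :: "real \<Rightarrow> real"
  assumes "continuous_on UNIV k"
  obtains F where "\<And>x. (F has_real_derivative k x) (at x)"
proof -
  have "\<exists>F. \<forall>x::real. -\<infinity> < ereal x \<longrightarrow> ereal x < \<infinity> \<longrightarrow> (F has_vector_derivative k x) (at x)"
    by (rule einterval_antiderivative)
       (use assms in \<open>auto simp: continuous_on_eq_continuous_at\<close>)
  then show ?thesis
    using that by (auto simp: has_real_derivative_iff_has_vector_derivative)
qed

text \<open>Averaging \<open>h\<close> over \<open>[x, x + \<epsilon>]\<close> moves its value by at most \<open>\<epsilon>\<close> and has the derivative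
\<open>(h(x + \<epsilon>) - h(x)) / \<epsilon>\<close>. This lets Stein's equation be differentiated without any use of the
differentiability of Lipschitz functions almost everywhere.\<close>

lemma lipschitz_smooth_approximation:
  fixes h :: "real \<Rightarrow> real"
  assumes h: "1-lipschitz_on UNIV h" and \<epsilon>: "0 < \<epsilon>"
  obtains k k' where "\<And>x. (k has_real_derivative k' x) (at x)"
    and "\<And>x. \<bar>k' x\<bar> \<le> 1" and "\<And>x. \<bar>k x - h x\<bar> \<le> \<epsilon>"
proof -
  obtain P where P: "\<And>x. (P has_real_derivative h x) (at x)"
    by (rule continuous_antiderivative_exists [OF lipschitz_on_continuous_on [OF h]]) blast
  define k where "k = (\<lambda>x. (P (x + \<epsilon>) - P x) / \<epsilon>)"
  have P': "((\<lambda>x. P (x + \<epsilon>)) has_real_derivative h (x + \<epsilon>)) (at x)" for x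
    using P [of "x + \<epsilon>"] by (simp add: DERIV_shift)
  have "(k has_real_derivative (h (x + \<epsilon>) - h x) / \<epsilon>) (at x)" for x
    using \<epsilon> unfolding k_def by (auto intro!: derivative_eq_intros P P')
  moreover have "\<bar>(h (x + \<epsilon>) - h x) / \<epsilon>\<bar> \<le> 1" for x
    using lipschitz_on_realD(1) [OF h, of "x + \<epsilon>" x] \<epsilon> by (simp add: field_simps)
  moreover have "\<bar>k x - h x\<bar> \<le> \<epsilon>" for x
  proof -
    obtain z where z: "x < z" "z < x + \<epsilon>" "P (x + \<epsilon>) - P x = (x + \<epsilon> - x) * h z"
      using MVT2 [of x "x + \<epsilon>" P h] P \<epsilon> by auto
    then have "k x = h z"
      using \<epsilon> by (simp add: k_def)
    with lipschitz_on_realD(1) [OF h, of z x] z show ?thesis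
      by simp
  qed
  ultimately show ?thesis
    by (rule that)
qed

text \<open>Both \<open>G - F\<close> and \<open>G + F\<close> are nondecreasing.\<close>

lemma increment_le_if_deriv_le:
  fixes F G f g :: "real \<Rightarrow> real"
  assumes F: "\<And>x. (F has_real_derivative f x) (at x)"
    and G: "\<And>x. (G has_real_derivative g x) (at x)"
    and le: "\<And>x. \<bar>f x\<bar> \<le> g x"
  shows "\<bar>F x - F y\<bar> \<le> \<bar>G x - G y\<bar>"
proof -
  have *: "\<bar>F b - F a\<bar> \<le> G b - G a" if "a \<le> b" for a b
  proof -
    have "G a - F a \<le> G b - F b"
    proof (rule DERIV_nonneg_imp_nondecreasing [OF that])
      fix z
      show "\<exists>d. ((\<lambda>z. G z - F z) has_real_derivative d) (at z) \<and> 0 \<le> d"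
        using le [of z] by (intro exI [of _ "g z - f z"]) (auto intro!: derivative_eq_intros F G)
    qed
    moreover have "G a + F a \<le> G b + F b"
    proof (rule DERIV_nonneg_imp_nondecreasing [OF that])
      fix z
      show "\<exists>d. ((\<lambda>z. G z + F z) has_real_derivative d) (at z) \<and> 0 \<le> d"
        using le [of z] by (intro exI [of _ "g z + f z"]) (auto intro!: derivative_eq_intros F G)
    qed
    ultimately show ?thesis
      by linarith
  qed
  show ?thesis
    using * [of x y] * [of y x] by linarith
qed

text \<open>Choosing the antiderivative \<open>x \<bar>x\<bar> / 2\<close> of \<open>\<bar>x\<bar>\<close> makes the comparison of increments work on both sides
of the origin at once.\<close>

lemma has_real_derivative_half_square_signed:
  "((\<lambda>x. x * \<bar>x\<bar> / 2) has_real_derivative \<bar>x\<bar>) (at (x::real))"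
proof (cases "x = 0")
  case True
  have "((\<lambda>h. \<bar>h\<bar> / 2) \<longlongrightarrow> \<bar>0::real\<bar> / 2) (at 0)"
    by (intro tendsto_intros) auto
  then have "((\<lambda>h. ((x + h) * \<bar>x + h\<bar> / 2 - x * \<bar>x\<bar> / 2) / h) \<longlongrightarrow> 0) (at 0)"
    unfolding True by (rule filterlim_cong [THEN iffD1, rotated -1])
      (auto simp: eventually_at_filter)
  with True show ?thesis
    by (simp add: DERIV_def)
next
  case False
  show ?thesis
  proof (rule has_field_derivative_transform_within_open)
    show "((\<lambda>y. sgn x * y\<^sup>2 / 2) has_real_derivative \<bar>x\<bar>) (at x)"
      by (auto intro!: derivative_eq_intros simp: abs_sgn)
    show "open {y. 0 < x * y}"
      by (intro open_Collect_less continuous_intros)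
    show "sgn x * y\<^sup>2 / 2 = y * \<bar>y\<bar> / 2" if "y \<in> {y. 0 < x * y}" for y
      using that False by (auto simp: sgn_if zero_less_mult_iff power2_eq_square)
  qed (use False linorder_neq_iff [of x 0] in \<open>auto simp: zero_less_mult_iff\<close>)
qed

lemma antiderivative_of_lipschitz_le:
  fixes H h :: "real \<Rightarrow> real"
  assumes H: "\<And>x. (H has_real_derivative h x) (at x)" and h: "L-lipschitz_on UNIV h"
    and zero: "h 0 = 0" "H 0 = 0"
  shows "\<bar>H x\<bar> \<le> L * x\<^sup>2 / 2"
proof -
  have "\<bar>H x - H 0\<bar> \<le> \<bar>L * (x * \<bar>x\<bar> / 2) - L * (0 * \<bar>0\<bar> / 2)\<bar>"
  proof (rule increment_le_if_deriv_le [where F = H and G = "\<lambda>x. L * (x * \<bar>x\<bar> / 2)"])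
    show "((\<lambda>x. L * (x * \<bar>x\<bar> / 2)) has_real_derivative L * \<bar>x\<bar>) (at x)" for x
      by (rule DERIV_cmult has_real_derivative_half_square_signed)+
    show "\<bar>h x\<bar> \<le> L * \<bar>x\<bar>" for x
      using lipschitz_on_realD(1) [OF h, of x 0] zero by simp
  qed (rule H)
  also have "\<dots> = L * x\<^sup>2 / 2"
    using lipschitz_on_realD(2) [OF h] by (simp add: abs_mult power2_eq_square)
  finally show ?thesis
    using zero by simp
qed

lemma antiderivative_of_lipschitz_growth:
  fixes H h :: "real \<Rightarrow> real"
  assumes H: "\<And>x. (H has_real_derivative h x) (at x)" and h: "L-lipschitz_on UNIV h"
  shows "\<bar>H x\<bar> \<le> \<bar>H 0\<bar> + \<bar>h 0\<bar> * \<bar>x\<bar> + L * x\<^sup>2 / 2"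
proof -
  have "\<bar>H x - H 0 - h 0 * x\<bar> \<le> L * x\<^sup>2 / 2"
  proof (rule antiderivative_of_lipschitz_le [where h = "\<lambda>x. h x - h 0"])
    show "((\<lambda>x. H x - H 0 - h 0 * x) has_real_derivative h x - h 0) (at x)" for x
      by (auto intro!: derivative_eq_intros H)
    show "L-lipschitz_on UNIV (\<lambda>x. h x - h 0)"
      using h by (simp add: lipschitz_on_def dist_real_def)
  qed auto
  moreover have "\<bar>h 0 * x\<bar> = \<bar>h 0\<bar> * \<bar>x\<bar>"
    by (rule abs_mult)
  ultimately show ?thesis
    by linarith
qed

text \<open>The derivative of \<open>x H(x)\<close> is \<open>H(x) + x h(x)\<close>, and for \<open>h\<close> and \<open>H\<close> vanishing at \<open>0\<close> this is bounded by
\<open>L x\<^sup>2 / 2 + L x\<^sup>2\<close>, the derivative of \<open>L x\<^sup>3 / 2\<close>. This is where the third powers in \<open>\<beta>\<^sub>n\<close> come from.\<close>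

lemma times_antiderivative_increment_le:
  fixes H h :: "real \<Rightarrow> real"
  assumes H: "\<And>x. (H has_real_derivative h x) (at x)" and h: "L-lipschitz_on UNIV h"
    and zero: "h 0 = 0" "H 0 = 0"
  shows "\<bar>x * H x - y * H y\<bar> \<le> L / 2 * \<bar>x ^ 3 - y ^ 3\<bar>"
proof -
  have "\<bar>x * H x - y * H y\<bar> \<le> \<bar>L / 2 * x ^ 3 - L / 2 * y ^ 3\<bar>"
  proof (rule increment_le_if_deriv_le [where F = "\<lambda>x. x * H x" and G = "\<lambda>x. L / 2 * x ^ 3"])
    show "((\<lambda>x. x * H x) has_real_derivative H x + x * h x) (at x)" for x
      by (auto intro!: derivative_eq_intros H)
    show "((\<lambda>x. L / 2 * x ^ 3) has_real_derivative L / 2 * (3 * x\<^sup>2)) (at x)" for x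
      by (auto intro!: derivative_eq_intros)
    show "\<bar>H x + x * h x\<bar> \<le> L / 2 * (3 * x\<^sup>2)" for x
    proof -
      have "\<bar>x * h x\<bar> \<le> \<bar>x\<bar> * (L * \<bar>x\<bar>)"
        using lipschitz_on_realD(1) [OF h, of x 0] zero by (simp add: abs_mult mult_left_mono)
      also have "\<dots> = L * x\<^sup>2"
        by (simp add: power2_eq_square)
      finally have "\<bar>H x + x * h x\<bar> \<le> L * x\<^sup>2 / 2 + L * x\<^sup>2"
        using antiderivative_of_lipschitz_le [OF H h zero, of x] by linarith
      then show ?thesis
        by simp
    qed
  qed
  also have "\<dots> = \<bar>L / 2\<bar> * \<bar>x ^ 3 - y ^ 3\<bar>"
    by (simp only: abs_mult flip: right_diff_distrib)
  also have "\<bar>L / 2\<bar> = L / 2"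
    using lipschitz_on_realD(2) [OF h] by simp
  finally show ?thesis .
qed

section \<open>Integrability and moments\<close>

lemma le_one_plus_cube:
  fixes x :: real
  assumes "0 \<le> x"
  shows "x \<le> 1 + x ^ 3" "x\<^sup>2 \<le> 1 + x ^ 3"
proof -
  have "x \<le> 1 + x ^ 3 \<and> x\<^sup>2 \<le> 1 + x ^ 3"
  proof (cases "x \<le> 1")
    case True
    then show ?thesis
      using assms power_le_one [of x 2] zero_le_power [OF assms, of 3] by linarith
  next
    case False
    then have "x ^ 1 \<le> x ^ 3" "x\<^sup>2 \<le> x ^ 3"
      by (intro power_increasing; simp)+
    then show ?thesis
      by simp
  qed
  then show "x \<le> 1 + x ^ 3" "x\<^sup>2 \<le> 1 + x ^ 3"
    by auto
qed

lemma (in prob_space) integrable_if_cube_integrable: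
  fixes f :: "'a \<Rightarrow> real"
  assumes f: "f \<in> borel_measurable M" "integrable M (\<lambda>x. \<bar>f x\<bar> ^ 3)"
  shows "integrable M f" "integrable M (\<lambda>x. (f x)\<^sup>2)"
proof -
  have dom: "integrable M (\<lambda>x. 1 + \<bar>f x\<bar> ^ 3)"
    using f(2) by simp
  show "integrable M f"
    by (rule Bochner_Integration.integrable_bound [OF dom f(1)])
       (use le_one_plus_cube(1) [of "\<bar>f _\<bar>"] in \<open>auto intro!: always_eventually\<close>)
  show "integrable M (\<lambda>x. (f x)\<^sup>2)"
    by (rule Bochner_Integration.integrable_bound [OF dom])
       (use f(1) le_one_plus_cube(2) [of "\<bar>f _\<bar>"] in \<open>auto intro!: always_eventually\<close>)
qed

lemma integrable_cube_add:
  fixes f g :: "'a \<Rightarrow> real"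
  assumes f: "f \<in> borel_measurable M" "integrable M (\<lambda>x. \<bar>f x\<bar> ^ 3)"
    and g: "g \<in> borel_measurable M" "integrable M (\<lambda>x. \<bar>g x\<bar> ^ 3)"
  shows "integrable M (\<lambda>x. \<bar>f x + g x\<bar> ^ 3)"
proof (rule Bochner_Integration.integrable_bound)
  show "integrable M (\<lambda>x. 8 * (\<bar>f x\<bar> ^ 3 + \<bar>g x\<bar> ^ 3))"
    using f g by simp
  show "AE x in M. norm (\<bar>f x + g x\<bar> ^ 3) \<le> norm (8 * (\<bar>f x\<bar> ^ 3 + \<bar>g x\<bar> ^ 3))"
  proof (intro always_eventually allI)
    fix x
    have "\<bar>f x + g x\<bar> ^ 3 \<le> (2 * max \<bar>f x\<bar> \<bar>g x\<bar>) ^ 3"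
      by (rule power_mono) auto
    also have "\<dots> = 8 * max \<bar>f x\<bar> \<bar>g x\<bar> ^ 3"
      by (simp add: power_mult_distrib)
    also have "\<dots> \<le> 8 * (\<bar>f x\<bar> ^ 3 + \<bar>g x\<bar> ^ 3)"
      by (auto simp: max_def)
    finally show "norm (\<bar>f x + g x\<bar> ^ 3) \<le> norm (8 * (\<bar>f x\<bar> ^ 3 + \<bar>g x\<bar> ^ 3))"
      by simp
  qed
qed (use f g in measurable)

lemma integrable_cube_sum:
  fixes f :: "'i \<Rightarrow> 'a \<Rightarrow> real"
  assumes "finite I" "\<And>i. i \<in> I \<Longrightarrow> f i \<in> borel_measurable M"
    and "\<And>i. i \<in> I \<Longrightarrow> integrable M (\<lambda>x. \<bar>f i x\<bar> ^ 3)"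
  shows "integrable M (\<lambda>x. \<bar>\<Sum>i\<in>I. f i x\<bar> ^ 3)"
  using assms by (induction rule: finite_induct) (auto intro!: integrable_cube_add)

text \<open>As \<open>H\<close> grows quadratically, \<open>\<bar>U H(Y)\<bar>\<close> is dominated by powers of \<open>\<bar>U\<bar>\<close> and \<open>\<bar>Y\<bar>\<close> of order at most three.\<close>

lemma (in prob_space) integrable_times_antiderivative:
  fixes U Y :: "'a \<Rightarrow> real"
  assumes U: "U \<in> borel_measurable M" "integrable M (\<lambda>\<omega>. \<bar>U \<omega>\<bar> ^ 3)"
    and Y: "Y \<in> borel_measurable M" "integrable M (\<lambda>\<omega>. \<bar>Y \<omega>\<bar> ^ 3)"
    and H: "\<And>x. (H has_real_derivative h x) (at x)" and h: "L-lipschitz_on UNIV h"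
  shows "integrable M (\<lambda>\<omega>. U \<omega> * H (Y \<omega>))"
proof -
  have [measurable]: "H \<in> borel_measurable borel"
    by (rule deriv_imp_borel_measurable [OF H])
  note [measurable] = U(1) Y(1)
  note U' = integrable_if_cube_integrable [OF U]
  note Y' = integrable_if_cube_integrable [OF Y]
  let ?B = "\<lambda>\<omega>. \<bar>H 0\<bar> * \<bar>U \<omega>\<bar> + \<bar>h 0\<bar> * ((U \<omega>)\<^sup>2 + (Y \<omega>)\<^sup>2) + L / 2 * (\<bar>U \<omega>\<bar> ^ 3 + \<bar>Y \<omega>\<bar> ^ 3)"
  show ?thesis
  proof (rule Bochner_Integration.integrable_bound)
    show "integrable M ?B"
      using U U' Y Y' by simp
    show "AE \<omega> in M. norm (U \<omega> * H (Y \<omega>)) \<le> norm (?B \<omega>)"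
    proof (intro always_eventually allI)
      fix \<omega>
      define u y where "u = \<bar>U \<omega>\<bar>" and "y = \<bar>Y \<omega>\<bar>"
      have nn: "0 \<le> u" "0 \<le> y" "0 \<le> L"
        using lipschitz_on_realD(2) [OF h] by (auto simp: u_def y_def)
      have uy: "u * y \<le> u\<^sup>2 + y\<^sup>2"
        using sum_squares_bound [of u y] nn mult_nonneg_nonneg [of u y] by linarith
      have uyy: "u * y\<^sup>2 \<le> u ^ 3 + y ^ 3"
      proof (cases "u \<le> y")
        case True
        then have "u * y\<^sup>2 \<le> y * y\<^sup>2" by (simp add: mult_right_mono)
        with nn show ?thesis by (simp add: power2_eq_square power3_eq_cube add_increasing)
      next
        case False
        then have "u * y\<^sup>2 \<le> u * u\<^sup>2" using nn by (intro mult_left_mono power_mono) auto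
        with nn show ?thesis by (simp add: power2_eq_square power3_eq_cube add_increasing2)
      qed
      have "\<bar>U \<omega> * H (Y \<omega>)\<bar> \<le> u * (\<bar>H 0\<bar> + \<bar>h 0\<bar> * y + L * y\<^sup>2 / 2)"
        using antiderivative_of_lipschitz_growth [OF H h, of "Y \<omega>"]
        by (simp add: abs_mult u_def y_def mult_left_mono)
      also have "\<dots> = \<bar>H 0\<bar> * u + \<bar>h 0\<bar> * (u * y) + L / 2 * (u * y\<^sup>2)"
        by (simp add: algebra_simps)
      also have "\<dots> \<le> \<bar>H 0\<bar> * u + \<bar>h 0\<bar> * (u\<^sup>2 + y\<^sup>2) + L / 2 * (u ^ 3 + y ^ 3)"
        using uy uyy nn by (intro add_mono mult_left_mono) auto
      also have "\<dots> = ?B \<omega>"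
        by (simp add: u_def y_def)
      finally show "norm (U \<omega> * H (Y \<omega>)) \<le> norm (?B \<omega>)"
        unfolding real_norm_def by linarith
    qed
  qed measurable
qed

lemma (in prob_space) integrable_if_distr:
  assumes "U \<in> borel_measurable M" "distr M borel U = \<mu>" "integrable \<mu> g" "g \<in> borel_measurable borel"
  shows "integrable M (\<lambda>\<omega>. g (U \<omega>) :: real)"
  using assms integrable_distr_eq [of U M borel g] by auto

lemma (in prob_space) abs_integral_le_const:
  fixes f :: "'a \<Rightarrow> real"
  assumes "integrable M f" "\<And>x. \<bar>f x\<bar> \<le> c"
  shows "\<bar>\<integral>x. f x \<partial>M\<bar> \<le> c"
proof -
  have "\<bar>\<integral>x. f x \<partial>M\<bar> \<le> (\<integral>x. \<bar>f x\<bar> \<partial>M)"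
    by (rule integral_abs_bound)
  also have "\<dots> \<le> (\<integral>x. c \<partial>M)"
    using assms by (intro integral_mono) auto
  finally show ?thesis
    using prob_space by simp
qed

text \<open>The Cauchy-Schwarz inequality, by nonnegativity of the quadratic polynomial
\<open>t \<mapsto> \<integral> (t \<bar>f\<bar> + \<bar>g\<bar>)\<^sup>2\<close>.\<close>

lemma integral_abs_mult_le:
  fixes f g :: "'a \<Rightarrow> real"
  assumes f: "f \<in> borel_measurable M" "integrable M (\<lambda>x. (f x)\<^sup>2)"
    and g: "g \<in> borel_measurable M" "integrable M (\<lambda>x. (g x)\<^sup>2)"
  shows "integrable M (\<lambda>x. f x * g x)"
    and "(\<integral>x. \<bar>f x * g x\<bar> \<partial>M) \<le> sqrt (\<integral>x. (f x)\<^sup>2 \<partial>M) * sqrt (\<integral>x. (g x)\<^sup>2 \<partial>M)"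
proof -
  note [measurable] = f(1) g(1)
  show int: "integrable M (\<lambda>x. f x * g x)"
  proof (rule Bochner_Integration.integrable_bound)
    show "integrable M (\<lambda>x. (f x)\<^sup>2 + (g x)\<^sup>2)"
      using f g by simp
    show "AE x in M. norm (f x * g x) \<le> norm ((f x)\<^sup>2 + (g x)\<^sup>2)"
    proof (intro always_eventually allI)
      fix x
      show "norm (f x * g x) \<le> norm ((f x)\<^sup>2 + (g x)\<^sup>2)"
        using sum_squares_bound [of "\<bar>f x\<bar>" "\<bar>g x\<bar>"] mult_nonneg_nonneg [of "\<bar>f x\<bar>" "\<bar>g x\<bar>"]
        by (simp add: abs_mult del: mult_nonneg_nonneg)
    qed
  qed measurable
  define A B C where "A = (\<integral>x. (f x)\<^sup>2 \<partial>M)" and "B = (\<integral>x. (g x)\<^sup>2 \<partial>M)"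
    and "C = (\<integral>x. \<bar>f x * g x\<bar> \<partial>M)"
  have nonneg: "0 \<le> A" "0 \<le> B" "0 \<le> C"
    by (simp_all add: A_def B_def C_def)
  have quad: "0 \<le> t\<^sup>2 * A + 2 * t * C + B" for t
  proof -
    have "0 \<le> (\<integral>x. (t * \<bar>f x\<bar> + \<bar>g x\<bar>)\<^sup>2 \<partial>M)"
      by simp
    also have "\<dots> = (\<integral>x. t\<^sup>2 * (f x)\<^sup>2 + 2 * t * \<bar>f x * g x\<bar> + (g x)\<^sup>2 \<partial>M)"
      by (rule Bochner_Integration.integral_cong)
         (auto simp: power2_sum power_mult_distrib abs_mult)
    also have "\<dots> = t\<^sup>2 * A + 2 * t * C + B"
      using f g int by (simp add: A_def B_def C_def)
    finally show ?thesis .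
  qed
  have "C\<^sup>2 \<le> A * B"
  proof (cases "A = 0")
    case True
    have "C = 0"
    proof (rule ccontr)
      assume "C \<noteq> 0"
      then show False
        using quad [of "- (B + 1) / (2 * C)"] True by (simp add: field_simps)
    qed
    with nonneg show ?thesis
      by simp
  next
    case False
    then show ?thesis
      using quad [of "- C / A"] nonneg by (simp add: field_simps power2_eq_square)
  qed
  then have "C \<le> sqrt (A * B)"
    by (rule real_le_rsqrt)
  then show "(\<integral>x. \<bar>f x * g x\<bar> \<partial>M) \<le> sqrt (\<integral>x. (f x)\<^sup>2 \<partial>M) * sqrt (\<integral>x. (g x)\<^sup>2 \<partial>M)"
    by (simp add: A_def B_def C_def real_sqrt_mult)
qed

lemma (in prob_space) integrable_square_if_fourth:
  fixes f :: "'a \<Rightarrow> real"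
  assumes f: "f \<in> borel_measurable M" "integrable M (\<lambda>x. f x ^ 4)"
  shows "integrable M (\<lambda>x. (f x)\<^sup>2)"
proof (rule Bochner_Integration.integrable_bound)
  show "integrable M (\<lambda>x. 1 + f x ^ 4)"
    using f by simp
  show "AE x in M. norm ((f x)\<^sup>2) \<le> norm (1 + f x ^ 4)"
  proof (intro always_eventually allI)
    fix x
    have "2 * (f x)\<^sup>2 \<le> 1 + ((f x)\<^sup>2)\<^sup>2"
      using sum_squares_bound [of 1 "(f x)\<^sup>2"] by simp
    then have "(f x)\<^sup>2 \<le> 1 + ((f x)\<^sup>2)\<^sup>2"
      using zero_le_power2 [of "f x"] by linarith
    then show "norm ((f x)\<^sup>2) \<le> norm (1 + f x ^ 4)"
      by simp
  qed
qed (use f in measurable)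

lemma (in prob_space) integrable_cube_if_fourth:
  fixes f :: "'a \<Rightarrow> real"
  assumes f: "f \<in> borel_measurable M" "integrable M (\<lambda>x. f x ^ 4)"
  shows "integrable M (\<lambda>x. \<bar>f x\<bar> ^ 3)"
proof (rule Bochner_Integration.integrable_bound)
  show "integrable M (\<lambda>x. 1 + f x ^ 4)"
    using f by simp
  show "AE x in M. norm (\<bar>f x\<bar> ^ 3) \<le> norm (1 + f x ^ 4)"
  proof (intro always_eventually allI)
    fix x
    have "\<bar>f x\<bar> ^ 3 \<le> 1 + \<bar>f x\<bar> ^ 4"
    proof (cases "\<bar>f x\<bar> \<le> 1")
      case True
      then have "\<bar>f x\<bar> ^ 3 \<le> 1"
        by (intro power_le_one) auto
      then show ?thesis
        by (simp add: add_increasing2)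
    next
      case False
      then have "\<bar>f x\<bar> ^ 3 \<le> \<bar>f x\<bar> ^ 4"
        by (intro power_increasing) auto
      then show ?thesis
        by simp
    qed
    then show "norm (\<bar>f x\<bar> ^ 3) \<le> norm (1 + f x ^ 4)"
      by (simp add: power_even_abs_numeral)
  qed
qed (use f in measurable)

section \<open>Stein equation for the standard normal law\<close>

lemma std_normal_density_has_derivative:
  "(std_normal_density has_real_derivative - x * std_normal_density x) (at x)"
  unfolding std_normal_density_def [abs_def]
  by (auto intro!: derivative_eq_intros simp: field_simps)

text \<open>The comparison principle for the operator \<open>v \<mapsto> v' - y v\<close>: its integrating factor is the Gaussian
density, so \<open>v\<close> times the density is nondecreasing on \<open>[x, \<infinity>)\<close>. Tending to \<open>0\<close>, it is nonpositive.\<close>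

lemma nonpos_if_gaussian_supersolution:
  fixes v v' :: "real \<Rightarrow> real"
  assumes deriv: "\<And>y. x \<le> y \<Longrightarrow> (v has_real_derivative v' y) (at y)"
    and super: "\<And>y. x \<le> y \<Longrightarrow> y * v y \<le> v' y"
    and lim: "((\<lambda>y. v y * std_normal_density y) \<longlongrightarrow> 0) at_top"
  shows "v x \<le> 0"
proof -
  let ?w = "\<lambda>y. v y * std_normal_density y"
  have der: "(?w has_real_derivative (v' y - y * v y) * std_normal_density y) (at y)" if "x \<le> y" for y
    by (rule derivative_eq_intros deriv that std_normal_density_has_derivative)+ (simp add: algebra_simps)
  have mono: "?w x \<le> ?w y" if "x \<le> y" for y
  proof (rule DERIV_nonneg_imp_nondecreasing [OF that])
    fix z assume "x \<le> z" "z \<le> y"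
    then show "\<exists>d. (?w has_real_derivative d) (at z) \<and> 0 \<le> d"
      using der super by (intro exI[of _ "(v' z - z * v z) * std_normal_density z"]) auto
  qed
  have "?w x \<le> 0"
    by (rule tendsto_lowerbound [OF lim])
       (auto simp: eventually_at_top_linorder intro!: exI[of _ x] mono)
  moreover have "0 < std_normal_density x"
    by (simp add: normal_density_pos)
  ultimately show ?thesis
    by (simp add: mult_le_0_iff)
qed

text \<open>On the half line \<open>y \<ge> 0\<close> the function \<open>b(y) = 2 + exp (- y)\<close> is a bounded barrier: it satisfies
\<open>b' - y b \<le> - (y + 1)\<close>, because \<open>(1 + y) exp (- y) \<ge> 1 - y\<close>. The comparison principle applied to
\<open>f - b\<close> and \<open>- f - b\<close> gives \<open>\<bar>f\<bar> \<le> b\<close>.\<close>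

lemma stein_solution_bound_half_line:
  fixes f g :: "real \<Rightarrow> real"
  assumes f: "\<And>x. (f has_real_derivative x * f x + g x) (at x)"
    and g: "\<And>x. \<bar>g x\<bar> \<le> \<bar>x\<bar> + 1"
    and lim: "((\<lambda>x. f x * std_normal_density x) \<longlongrightarrow> 0) at_top"
    and x: "0 \<le> x"
  shows "\<bar>f x\<bar> \<le> 3"
proof -
  have aux: "s * f x - (2 + exp (- x)) \<le> 0" if s: "s = 1 \<or> s = -1" for s
  proof (rule nonpos_if_gaussian_supersolution
      [where x = x and v = "\<lambda>y. s * f y - (2 + exp (- y))" and v' = "\<lambda>y. s * (y * f y + g y) + exp (- y)"])
    fix y assume "x \<le> y"
    with x have y: "0 \<le> y" by simp
    show "((\<lambda>y. s * f y - (2 + exp (- y))) has_real_derivative s * (y * f y + g y) + exp (- y)) (at y)"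
      by (auto intro!: derivative_eq_intros f)
    have "s * g y \<ge> - y - 1"
      using g [of y] s y by (auto simp: abs_le_iff)
    moreover have "exp (- y) \<ge> 1 - y"
      using exp_ge_add_one_self [of "- y"] by simp
    moreover have "y * exp (- y) \<ge> 0"
      using y by simp
    ultimately show "y * (s * f y - (2 + exp (- y))) \<le> s * (y * f y + g y) + exp (- y)"
      by (simp add: algebra_simps)
  next
    have "((\<lambda>y. (2 + exp (- y)) * std_normal_density y) \<longlongrightarrow> 0) at_top"
      unfolding std_normal_density_def by real_asymp
    from tendsto_diff [OF tendsto_mult_left [OF lim, of s] this]
    show "((\<lambda>y. (s * f y - (2 + exp (- y))) * std_normal_density y) \<longlongrightarrow> 0) at_top"
      by (simp add: algebra_simps)
  qed
  have "exp (- x) \<le> 1"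
    using x by simp
  with aux [of 1] aux [of "-1"] show ?thesis
    by linarith
qed

text \<open>The derivative \<open>u\<close> of \<open>f\<close> solves \<open>u' - y u = f + g'\<close>, again an equation of Stein's type, but with a
right-hand side bounded by \<open>3 + 1\<close>. The barrier \<open>4 / y\<close> satisfies \<open>b' - y b \<le> - 4\<close>, so that
\<open>\<bar>y u\<bar> \<le> 4\<close>, and \<open>f'' = u' = y u + (f + g')\<close> is bounded by \<open>8\<close>.\<close>

lemma stein_solution_second_derivative_half_line:
  fixes f g g' :: "real \<Rightarrow> real"
  assumes f: "\<And>x. (f has_real_derivative x * f x + g x) (at x)"
    and g': "\<And>x. (g has_real_derivative g' x) (at x)"
    and g'_le: "\<And>x. \<bar>g' x\<bar> \<le> 1"
    and g_le: "\<And>x. \<bar>g x\<bar> \<le> \<bar>x\<bar> + 1"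
    and lim: "((\<lambda>x. f x * std_normal_density x) \<longlongrightarrow> 0) at_top"
    and x: "0 \<le> x"
  shows "\<bar>f x + x * (x * f x + g x) + g' x\<bar> \<le> 8"
proof -
  have f_le: "\<bar>f y\<bar> \<le> 3" if "0 \<le> y" for y
    using stein_solution_bound_half_line [OF f g_le lim that] .
  define u where "u = (\<lambda>y. y * f y + g y)"
  have u: "(u has_real_derivative f y + y * u y + g' y) (at y)" for y
    unfolding u_def by (auto intro!: derivative_eq_intros f g' simp: algebra_simps)
  have rhs: "\<bar>f y + g' y\<bar> \<le> 4" if "0 \<le> y" for y
    using f_le [OF that] g'_le [of y] by linarith
  have u_lim: "((\<lambda>y. u y * std_normal_density y) \<longlongrightarrow> 0) at_top"
  proof (rule Lim_null_comparison)
    show "\<forall>\<^sub>F y in at_top. norm (u y * std_normal_density y) \<le> (4 * y + 1) * std_normal_density y"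
      using eventually_ge_at_top [of 0]
    proof eventually_elim
      case (elim y)
      have "\<bar>u y\<bar> \<le> y * \<bar>f y\<bar> + \<bar>g y\<bar>"
        unfolding u_def using elim abs_triangle_ineq [of "y * f y" "g y"] by (simp add: abs_mult)
      also have "\<dots> \<le> y * 3 + (y + 1)"
        using elim f_le [OF elim] g_le [of y] by (intro add_mono mult_left_mono) auto
      finally show ?case
        by (simp add: abs_mult mult_right_mono)
    qed
    show "((\<lambda>y. (4 * y + 1) * std_normal_density y) \<longlongrightarrow> 0) at_top"
      unfolding std_normal_density_def by real_asymp
  qed
  have "\<bar>x * u x\<bar> \<le> 4"
  proof (cases "x = 0")
    case False
    with x have x0: "0 < x" by simp
    have aux: "s * u x - 4 / x \<le> 0" if s: "s = 1 \<or> s = -1" for s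
    proof (rule nonpos_if_gaussian_supersolution
        [where x = x and v = "\<lambda>y. s * u y - 4 / y" and v' = "\<lambda>y. s * (f y + y * u y + g' y) + 4 / y^2"])
      fix y assume "x \<le> y"
      with x0 have y: "0 < y" by simp
      show "((\<lambda>y. s * u y - 4 / y) has_real_derivative s * (f y + y * u y + g' y) + 4 / y^2) (at y)"
        using y by (auto intro!: derivative_eq_intros u simp: field_simps power2_eq_square)
      have "s * (f y + g' y) \<ge> - 4"
        using rhs [of y] s y by (auto simp: abs_le_iff)
      moreover have "4 / y^2 \<ge> 0"
        by simp
      moreover have "y * (s * u y - 4 / y) = s * (y * u y) - 4"
        using y by (simp add: field_simps)
      ultimately show "y * (s * u y - 4 / y) \<le> s * (f y + y * u y + g' y) + 4 / y^2"
        unfolding distrib_left by linarith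
    next
      have "((\<lambda>y. 4 / y * std_normal_density y) \<longlongrightarrow> 0) at_top"
        unfolding std_normal_density_def by real_asymp
      from tendsto_diff [OF tendsto_mult_left [OF u_lim, of s] this]
      show "((\<lambda>y. (s * u y - 4 / y) * std_normal_density y) \<longlongrightarrow> 0) at_top"
        by (simp add: algebra_simps)
    qed
    from aux [of 1] aux [of "-1"] have "\<bar>u x\<bar> \<le> 4 / x"
      by (simp add: abs_le_iff)
    with x0 show ?thesis
      by (simp add: abs_mult field_simps)
  qed simp
  with rhs [OF x] show ?thesis
    unfolding u_def by linarith
qed

text \<open>The negative half line follows by reflection: \<open>y \<mapsto> - f(- y)\<close> solves the equation with right-hand side
\<open>y \<mapsto> g(- y)\<close>.\<close>

lemma stein_solution_second_derivative:
  fixes f g g' :: "real \<Rightarrow> real"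
  assumes f: "\<And>x. (f has_real_derivative x * f x + g x) (at x)"
    and g': "\<And>x. (g has_real_derivative g' x) (at x)"
    and g'_le: "\<And>x. \<bar>g' x\<bar> \<le> 1"
    and g_le: "\<And>x. \<bar>g x\<bar> \<le> \<bar>x\<bar> + 1"
    and lim_top: "((\<lambda>x. f x * std_normal_density x) \<longlongrightarrow> 0) at_top"
    and lim_bot: "((\<lambda>x. f x * std_normal_density x) \<longlongrightarrow> 0) at_bot"
  shows "\<bar>f x + x * (x * f x + g x) + g' x\<bar> \<le> 8"
proof (cases "0 \<le> x")
  case True
  then show ?thesis
    using stein_solution_second_derivative_half_line [OF f g' g'_le g_le lim_top] by blast
next
  case False
  have "\<bar>- f (- (- x)) + (- x) * ((- x) * (- f (- (- x))) + g (- (- x))) + (- g' (- (- x)))\<bar> \<le> 8"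
  proof (rule stein_solution_second_derivative_half_line
      [where f = "\<lambda>y. - f (- y)" and g = "\<lambda>y. g (- y)" and g' = "\<lambda>y. - g' (- y)" and x = "- x"])
    show "((\<lambda>y. - f (- y)) has_real_derivative y * (- f (- y)) + g (- y)) (at y)" for y
      using DERIV_minus [OF f [of "- y", unfolded DERIV_mirror]] by simp
    show "((\<lambda>y. g (- y)) has_real_derivative - g' (- y)) (at y)" for y
      using g' [of "- y", unfolded DERIV_mirror] by simp
    have "((\<lambda>y. f (- y) * std_normal_density (- y)) \<longlongrightarrow> 0) at_top"
      using lim_bot unfolding filterlim_at_bot_mirror .
    then show "((\<lambda>y. - f (- y) * std_normal_density y) \<longlongrightarrow> 0) at_top"
      using tendsto_minus by (fastforce simp: std_normal_density_def)
  qed (use g'_le [of "- _"] g_le [of "- _"] False in \<open>auto\<close>)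
  moreover have "- f (- (- x)) + (- x) * ((- x) * (- f (- (- x))) + g (- (- x))) + (- g' (- (- x)))
      = - (f x + x * (x * f x + g x) + g' x)"
    by (simp add: algebra_simps)
  ultimately show ?thesis
    by (metis abs_minus_cancel)
qed

lemma integral_std_normal_distribution:
  assumes "h \<in> borel_measurable borel"
  shows "(\<integral>x. h x \<partial>std_normal_distribution) = (\<integral>x. std_normal_density x * h x \<partial>lborel)"
  using assms by (subst integral_density) (auto simp: normal_density_nonneg)

lemma integrable_std_normal_distribution_iff:
  assumes "h \<in> borel_measurable borel"
  shows "integrable std_normal_distribution h \<longleftrightarrow> integrable lborel (\<lambda>x. std_normal_density x * h x)"
  using assms by (subst integrable_density) (auto simp: normal_density_nonneg)

lemma integrable_std_normal_identity: "integrable std_normal_distribution (\<lambda>x. x)"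
  using integrable_std_normal_moment [of 1] by (subst integrable_std_normal_distribution_iff) auto

text \<open>From \<open>\<bar>x\<bar> \<le> (1 + x\<^sup>2) / 2\<close> and unit variance; the exact value \<open>sqrt (2 / pi)\<close> would only improve constants.\<close>

lemma integral_abs_std_normal_le: "(\<integral>x. \<bar>x\<bar> \<partial>std_normal_distribution) \<le> 1"
proof -
  interpret real_distribution std_normal_distribution
    by (rule real_dist_normal_dist)
  have sq: "integrable std_normal_distribution (\<lambda>x. x\<^sup>2)" "(\<integral>x. x\<^sup>2 \<partial>std_normal_distribution) = 1"
    using std_normal_distribution_even_moments [of 1] by auto
  have "(\<integral>x. \<bar>x\<bar> \<partial>std_normal_distribution) \<le> (\<integral>x. (1 + x\<^sup>2) / 2 \<partial>std_normal_distribution)"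
  proof (rule integral_mono)
    fix x :: real
    show "\<bar>x\<bar> \<le> (1 + x\<^sup>2) / 2"
      using zero_le_power2 [of "\<bar>x\<bar> - 1"] by (simp add: power2_diff)
  qed (use sq integrable_std_normal_identity in auto)
  also have "\<dots> = 1"
    using sq prob_space by simp
  finally show ?thesis .
qed

lemma lipschitz_centred_bound:
  fixes h :: "real \<Rightarrow> real"
  assumes h: "1-lipschitz_on UNIV h"
  shows "\<bar>h x - (\<integral>y. h y \<partial>std_normal_distribution)\<bar> \<le> \<bar>x\<bar> + 1"
proof -
  interpret real_distribution std_normal_distribution
    by (rule real_dist_normal_dist)
  have int: "integrable std_normal_distribution h"
    by (rule integrable_lipschitz [OF real_dist_normal_dist integrable_std_normal_identity h])
  have int_x: "integrable std_normal_distribution (\<lambda>y. x - y)"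
    using integrable_std_normal_identity by simp
  have "h x - (\<integral>y. h y \<partial>std_normal_distribution) = (\<integral>y. h x - h y \<partial>std_normal_distribution)"
    using int prob_space by simp
  also have "\<bar>\<dots>\<bar> \<le> (\<integral>y. \<bar>h x - h y\<bar> \<partial>std_normal_distribution)"
    by (rule integral_abs_bound)
  also have "\<dots> \<le> (\<integral>y. \<bar>x\<bar> + \<bar>y\<bar> \<partial>std_normal_distribution)"
  proof (rule integral_mono)
    show "\<bar>h x - h y\<bar> \<le> \<bar>x\<bar> + \<bar>y\<bar>" for y
      using lipschitz_on_realD(1) [OF h, of x y] by simp
  qed (use int integrable_std_normal_identity in auto)
  also have "\<dots> \<le> \<bar>x\<bar> + 1"
    using integral_abs_std_normal_le integrable_std_normal_identity prob_space by simp
  finally show ?thesis .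
qed

lemma antiderivative_vanishing_at_both_ends:
  fixes k :: "real \<Rightarrow> real"
  assumes cont: "continuous_on UNIV k" and int: "integrable lborel k"
    and zero: "(\<integral>x. k x \<partial>lborel) = 0"
  obtains G where "\<And>x. (G has_real_derivative k x) (at x)"
    and "(G \<longlongrightarrow> 0) at_top" and "(G \<longlongrightarrow> 0) at_bot"
proof -
  define G where "G = (\<lambda>y. \<integral>x. indicator {..y} x *\<^sub>R k x \<partial>lborel)"
  obtain F where F: "\<And>x. (F has_real_derivative k x) (at x)"
    by (rule continuous_antiderivative_exists [OF cont]) blast
  have int': "integrable lborel (\<lambda>x. indicator A x *\<^sub>R k x)" if "A \<in> sets borel" for A
    using int that by (intro integrable_mult_indicator) auto
  have diff: "G y - G x = F y - F x" if "x \<le> y" for x y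
  proof -
    have "G y - G x = (\<integral>t. indicator {..y} t *\<^sub>R k t - indicator {..x} t *\<^sub>R k t \<partial>lborel)"
      unfolding G_def by (rule Bochner_Integration.integral_diff [symmetric]) (rule int', simp)+
    also have "\<dots> = (\<integral>t. k t * indicator {x..y} t \<partial>lborel)"
    proof (rule integral_cong_AE)
      show "AE t in lborel. indicator {..y} t *\<^sub>R k t - indicator {..x} t *\<^sub>R k t = k t * indicator {x..y} t"
        using AE_lborel_singleton [of x]
        by eventually_elim (use that in \<open>auto simp: indicator_def\<close>)
    qed (use int in auto)
    also have "\<dots> = F y - F x"
      using that F cont by (intro integral_FTC_Icc_real) (auto simp: continuous_on_eq_continuous_at)
    finally show ?thesis .
  qed
  have G_eq: "G = (\<lambda>x. F x + (G 0 - F 0))"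
  proof
    fix x
    show "G x = F x + (G 0 - F 0)"
      using diff [of 0 x] diff [of x 0] by linarith
  qed
  have "(G has_real_derivative k x) (at x)" for x
    by (subst G_eq) (auto intro!: derivative_eq_intros F)
  moreover have "(G \<longlongrightarrow> 0) at_top"
    using tendsto_integral_at_top [of lborel k] int zero by (simp add: G_def)
  moreover have "(G \<longlongrightarrow> 0) at_bot"
  proof -
    have "((\<lambda>y. \<integral>x. indicator {..- y} x *\<^sub>R k x \<partial>lborel) \<longlongrightarrow> integral\<^sup>L lborel (\<lambda>_::real. 0::real)) at_top"
    proof (rule integral_dominated_convergence_at_top [where w = "\<lambda>x. \<bar>k x\<bar>"])
      show "\<forall>\<^sub>F y in at_top. AE x in lborel. norm (indicator {..- y} x *\<^sub>R k x) \<le> \<bar>k x\<bar>"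
        by (auto simp: indicator_def)
      show "AE x in lborel. ((\<lambda>y. indicator {..- y} x *\<^sub>R k x) \<longlongrightarrow> 0) at_top"
      proof (intro always_eventually allI)
        fix x :: real
        show "((\<lambda>y. indicator {..- y} x *\<^sub>R k x) \<longlongrightarrow> 0) at_top"
          by (rule tendsto_eventually, rule eventually_mono [OF eventually_gt_at_top [of "- x"]]) auto
      qed
    qed (use int in auto)
    then show ?thesis
      by (simp add: G_def filterlim_at_bot_mirror)
  qed
  ultimately show ?thesis
    using that by blast
qed

text \<open>The solution is \<open>f = G / p\<close>, where \<open>p\<close> is the normal density and \<open>G\<close> the antiderivative of
\<open>p (h - E h(N))\<close> vanishing at \<open>- \<infinity>\<close>. Centring makes \<open>G\<close> vanish at \<open>+ \<infinity>\<close> as well, which is what the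
comparison principle needs on both half lines.\<close>

lemma stein_equation_solution_exists:
  fixes h h' :: "real \<Rightarrow> real"
  assumes h': "\<And>x. (h has_real_derivative h' x) (at x)" and h'_le: "\<And>x. \<bar>h' x\<bar> \<le> 1"
  obtains f f' where "\<And>x. (f has_real_derivative f' x) (at x)"
    and "\<And>x. f' x - x * f x = h x - (\<integral>y. h y \<partial>std_normal_distribution)"
    and "8-lipschitz_on UNIV f'"
proof -
  interpret real_distribution std_normal_distribution
    by (rule real_dist_normal_dist)
  have lip: "1-lipschitz_on UNIV h"
    using h' h'_le by (rule lipschitz_on_if_deriv_bounded) auto
  define g where "g = (\<lambda>x. h x - (\<integral>y. h y \<partial>std_normal_distribution))"
  have h_meas [measurable]: "h \<in> borel_measurable borel"
    by (rule lipschitz_on_borel_measurable [OF lip])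
  have g_meas [measurable]: "g \<in> borel_measurable borel"
    unfolding g_def by simp
  have int_h: "integrable std_normal_distribution h"
    by (rule integrable_lipschitz [OF real_dist_normal_dist integrable_std_normal_identity lip])
  then have int_g: "integrable std_normal_distribution g"
    by (simp add: g_def)
  have g_zero: "(\<integral>x. g x \<partial>std_normal_distribution) = 0"
    using int_h prob_space by (simp add: g_def)
  have g': "(g has_real_derivative h' x) (at x)" for x
    unfolding g_def by (auto intro!: derivative_eq_intros h')
  have cont: "continuous_on UNIV (\<lambda>x. std_normal_density x * g x)"
    by (intro continuous_at_imp_continuous_on ballI isCont_mult
        DERIV_isCont [OF std_normal_density_has_derivative] DERIV_isCont [OF g'])
  obtain G where G: "\<And>x. (G has_real_derivative std_normal_density x * g x) (at x)"
    and G_top: "(G \<longlongrightarrow> 0) at_top" and G_bot: "(G \<longlongrightarrow> 0) at_bot"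
    using antiderivative_vanishing_at_both_ends [OF cont] int_g g_zero
    by (auto simp: integrable_std_normal_distribution_iff integral_std_normal_distribution)
  define f where "f = (\<lambda>x. G x / std_normal_density x)"
  have pos: "std_normal_density x \<noteq> 0" for x
    using normal_density_pos [of 1 0 x] by simp
  have f: "(f has_real_derivative x * f x + g x) (at x)" for x
    unfolding f_def
    by (rule derivative_eq_intros G std_normal_density_has_derivative pos)+
       (use pos [of x] in \<open>simp add: field_simps\<close>)
  have f_lim: "((\<lambda>x. f x * std_normal_density x) \<longlongrightarrow> 0) at_top"
    "((\<lambda>x. f x * std_normal_density x) \<longlongrightarrow> 0) at_bot"
    using G_top G_bot pos by (simp_all add: f_def)
  have bound: "\<bar>f x + x * (x * f x + g x) + h' x\<bar> \<le> 8" for x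
    using stein_solution_second_derivative [OF f g' h'_le _ f_lim] lipschitz_centred_bound [OF lip]
    by (auto simp: g_def)
  have f': "((\<lambda>x. x * f x + g x) has_real_derivative f x + x * (x * f x + g x) + h' x) (at x)" for x
    by (auto intro!: derivative_eq_intros f g')
  have "8-lipschitz_on UNIV (\<lambda>x. x * f x + g x)"
    using f' bound by (rule lipschitz_on_if_deriv_bounded) auto
  with f show ?thesis
    using that [of f "\<lambda>x. x * f x + g x"] by (simp add: g_def)
qed

section \<open>Stein discrepancy\<close>

text \<open>For a standardized law, \<open>K\<close> bounds the Wasserstein distance between \<open>\<mu>\<close> and its zero bias transform, the law under which
\<open>h\<close> has the expectation \<open>\<integral> x H(x) d\<mu>\<close>. Quantifying over all Lipschitz constants \<open>L\<close> instead of rescaling to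
\<open>L = 1\<close> includes \<open>L = 0\<close> and spares divisions by weights that may vanish.\<close>

definition stein_discrepancy_le :: "real measure \<Rightarrow> real \<Rightarrow> bool" where
  "stein_discrepancy_le \<mu> K \<longleftrightarrow>
     (\<forall>H h L. L-lipschitz_on UNIV h \<longrightarrow> (\<forall>x. (H has_real_derivative h x) (at x)) \<longrightarrow>
        \<bar>(\<integral>x. h x \<partial>\<mu>) - (\<integral>x. x * H x \<partial>\<mu>)\<bar> \<le> L * K)"

lemma stein_discrepancy_leD:
  assumes "stein_discrepancy_le \<mu> K" "L-lipschitz_on UNIV h"
    and "\<And>x. (H has_real_derivative h x) (at x)"
  shows "\<bar>(\<integral>x. h x \<partial>\<mu>) - (\<integral>x. x * H x \<partial>\<mu>)\<bar> \<le> L * K"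
  using assms unfolding stein_discrepancy_le_def by blast

text \<open>The third moment makes \<open>x H(x)\<close> integrable whenever \<open>H\<close> has a Lipschitz derivative.\<close>

locale standardized_law = real_distribution \<mu> for \<mu> :: "real measure" +
  assumes third_moment: "integrable \<mu> (\<lambda>x. \<bar>x\<bar> ^ 3)"
    and mean_zero: "(\<integral>x. x \<partial>\<mu>) = 0"
    and variance_one: "(\<integral>x. x\<^sup>2 \<partial>\<mu>) = 1"
begin

lemma measurable_identity: "(\<lambda>x. x) \<in> borel_measurable \<mu>"
  by (simp cong: measurable_cong_sets)

lemma integrable_identity: "integrable \<mu> (\<lambda>x. x)"
  and integrable_square: "integrable \<mu> (\<lambda>x. x\<^sup>2)"
  using integrable_if_cube_integrable [OF measurable_identity third_moment] by auto

lemma integrable_lipschitz_function: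
  fixes h :: "real \<Rightarrow> real"
  shows "L-lipschitz_on UNIV h \<Longrightarrow> integrable \<mu> h"
  by (rule integrable_lipschitz [OF real_distribution_axioms integrable_identity])

lemma integrable_identity_times_antiderivative:
  assumes "\<And>x. (H has_real_derivative h x) (at x)" "L-lipschitz_on UNIV h"
  shows "integrable \<mu> (\<lambda>x. x * H x)"
  by (rule integrable_times_antiderivative) (rule measurable_identity third_moment assms)+

text \<open>Subtracting an affine function from \<open>H\<close>, and its slope from \<open>h\<close>, does not change
\<open>\<integral> h - \<integral> x H\<close>: the constant term has no effect because the mean is zero, and the
slope contributes equally to both integrals because the variance is one.\<close>

lemma stein_discrepancy_leI:
  assumes *: "\<And>H h L. L-lipschitz_on UNIV h \<Longrightarrow> (\<And>x. (H has_real_derivative h x) (at x)) \<Longrightarrow>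
      h 0 = 0 \<Longrightarrow> H 0 = 0 \<Longrightarrow> \<bar>(\<integral>x. h x \<partial>\<mu>) - (\<integral>x. x * H x \<partial>\<mu>)\<bar> \<le> L * K"
  shows "stein_discrepancy_le \<mu> K"
  unfolding stein_discrepancy_le_def
proof (intro allI impI)
  fix H h :: "real \<Rightarrow> real" and L
  assume h: "L-lipschitz_on UNIV h" and H: "\<forall>x. (H has_real_derivative h x) (at x)"
  let ?h = "\<lambda>x. h x - h 0" and ?H = "\<lambda>x. H x - H 0 - h 0 * x"
  have int_h: "integrable \<mu> h"
    by (rule integrable_lipschitz_function [OF h])
  have int_H: "integrable \<mu> (\<lambda>x. x * H x)"
    using H h by (intro integrable_identity_times_antiderivative [of _ h]) auto
  have "(\<integral>x. x * ?H x \<partial>\<mu>) = (\<integral>x. x * H x - H 0 * x - h 0 * x\<^sup>2 \<partial>\<mu>)"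
    by (rule Bochner_Integration.integral_cong) (auto simp: algebra_simps power2_eq_square)
  also have "\<dots> = (\<integral>x. x * H x \<partial>\<mu>) - h 0"
    using int_H integrable_identity integrable_square by (simp add: mean_zero variance_one)
  finally have "(\<integral>x. ?h x \<partial>\<mu>) - (\<integral>x. x * ?H x \<partial>\<mu>) = (\<integral>x. h x \<partial>\<mu>) - (\<integral>x. x * H x \<partial>\<mu>)"
    using int_h prob_space by simp
  moreover have "\<bar>(\<integral>x. ?h x \<partial>\<mu>) - (\<integral>x. x * ?H x \<partial>\<mu>)\<bar> \<le> L * K"
  proof (rule *)
    show "(?H has_real_derivative ?h x) (at x)" for x
      using H by (auto intro!: derivative_eq_intros)
    show "L-lipschitz_on UNIV ?h"
      using h by (simp add: lipschitz_on_def dist_real_def)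
  qed auto
  ultimately show "\<bar>(\<integral>x. h x \<partial>\<mu>) - (\<integral>x. x * H x \<partial>\<mu>)\<bar> \<le> L * K"
    by simp
qed

lemma stein_discrepancy_finite:
  "stein_discrepancy_le \<mu> ((\<integral>x. \<bar>x\<bar> \<partial>\<mu>) + 1 / 2 * (\<integral>x. \<bar>x\<bar> ^ 3 \<partial>\<mu>))"
proof (rule stein_discrepancy_leI)
  fix H h :: "real \<Rightarrow> real" and L
  assume h: "L-lipschitz_on UNIV h" and H: "\<And>x. (H has_real_derivative h x) (at x)"
    and zero: "h 0 = 0" "H 0 = 0"
  have int_abs: "integrable \<mu> (\<lambda>x. \<bar>x\<bar>)"
    using integrable_identity by simp
  have "\<bar>\<integral>x. h x \<partial>\<mu>\<bar> \<le> (\<integral>x. \<bar>h x\<bar> \<partial>\<mu>)"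
    by (rule integral_abs_bound)
  also have "\<dots> \<le> (\<integral>x. L * \<bar>x\<bar> \<partial>\<mu>)"
    using lipschitz_on_realD(1) [OF h, of _ 0] zero integrable_lipschitz_function [OF h] int_abs
    by (intro integral_mono) auto
  finally have 1: "\<bar>\<integral>x. h x \<partial>\<mu>\<bar> \<le> L * (\<integral>x. \<bar>x\<bar> \<partial>\<mu>)"
    by simp
  have "\<bar>\<integral>x. x * H x \<partial>\<mu>\<bar> \<le> (\<integral>x. \<bar>x * H x\<bar> \<partial>\<mu>)"
    by (rule integral_abs_bound)
  also have "\<dots> \<le> (\<integral>x. L / 2 * \<bar>x\<bar> ^ 3 \<partial>\<mu>)"
    using times_antiderivative_increment_le [OF H h zero, of _ 0] third_moment
      integrable_identity_times_antiderivative [OF H h]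
    by (intro integral_mono) (auto simp: power_abs)
  finally have 2: "\<bar>\<integral>x. x * H x \<partial>\<mu>\<bar> \<le> L / 2 * (\<integral>x. \<bar>x\<bar> ^ 3 \<partial>\<mu>)"
    by simp
  show "\<bar>(\<integral>x. h x \<partial>\<mu>) - (\<integral>x. x * H x \<partial>\<mu>)\<bar>
      \<le> L * ((\<integral>x. \<bar>x\<bar> \<partial>\<mu>) + 1 / 2 * (\<integral>x. \<bar>x\<bar> ^ 3 \<partial>\<mu>))"
    using 1 2 by (simp add: distrib_left)
qed

text \<open>For a smooth \<open>k\<close> Stein's equation gives \<open>E k(W) - E k(N) = E (f'(W) - W f(W))\<close>, to which the discrepancy
applies with the pair \<open>f', f\<close> and the Lipschitz constant \<open>8\<close>; smooth functions are uniformly dense.\<close>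

lemma lipschitz_integral_normal_diff_le:
  assumes disc: "stein_discrepancy_le \<mu> K" and h: "1-lipschitz_on UNIV h"
  shows "\<bar>(\<integral>x. h x \<partial>\<mu>) - (\<integral>x. h x \<partial>std_normal_distribution)\<bar> \<le> 8 * K"
proof (rule field_le_epsilon)
  fix e :: real
  assume "0 < e"
  then have e: "0 < e / 2" by simp
  obtain k k' where k': "\<And>x. (k has_real_derivative k' x) (at x)" "\<And>x. \<bar>k' x\<bar> \<le> 1"
    and kh: "\<And>x. \<bar>k x - h x\<bar> \<le> e / 2"
    by (rule lipschitz_smooth_approximation [OF h e]) blast
  have k: "1-lipschitz_on UNIV k"
    using k' by (rule lipschitz_on_if_deriv_bounded) auto
  have close: "\<bar>(\<integral>x. h x \<partial>\<nu>) - (\<integral>x. k x \<partial>\<nu>)\<bar> \<le> e / 2"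
    if "real_distribution \<nu>" "integrable \<nu> (\<lambda>x. x)" for \<nu>
  proof -
    interpret \<nu>: real_distribution \<nu> by fact
    have int: "integrable \<nu> h" "integrable \<nu> k"
      using integrable_lipschitz [OF that] h k by blast+
    have "\<bar>(\<integral>x. h x \<partial>\<nu>) - (\<integral>x. k x \<partial>\<nu>)\<bar> = \<bar>\<integral>x. h x - k x \<partial>\<nu>\<bar>"
      using int by simp
    also have "\<dots> \<le> (\<integral>x. \<bar>h x - k x\<bar> \<partial>\<nu>)"
      by (rule integral_abs_bound)
    also have "\<dots> \<le> (\<integral>x. e / 2 \<partial>\<nu>)"
      using int kh by (intro integral_mono) (auto simp: abs_minus_commute)
    also have "\<dots> = e / 2"
      using \<nu>.prob_space by simp
    finally show ?thesis .
  qed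
  obtain f f' where f: "\<And>x. (f has_real_derivative f' x) (at x)"
    and stein: "\<And>x. f' x - x * f x = k x - (\<integral>y. k y \<partial>std_normal_distribution)"
    and f': "8-lipschitz_on UNIV f'"
    by (rule stein_equation_solution_exists [OF k']) blast
  have "(\<integral>x. k x \<partial>\<mu>) - (\<integral>y. k y \<partial>std_normal_distribution)
      = (\<integral>x. k x - (\<integral>y. k y \<partial>std_normal_distribution) \<partial>\<mu>)"
    using integrable_lipschitz_function [OF k] prob_space by simp
  also have "\<dots> = (\<integral>x. f' x - x * f x \<partial>\<mu>)"
    by (simp add: stein)
  also have "\<dots> = (\<integral>x. f' x \<partial>\<mu>) - (\<integral>x. x * f x \<partial>\<mu>)"
    using integrable_lipschitz_function [OF f'] integrable_identity_times_antiderivative [OF f f']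
    by simp
  finally have "\<bar>(\<integral>x. k x \<partial>\<mu>) - (\<integral>y. k y \<partial>std_normal_distribution)\<bar> \<le> 8 * K"
    using stein_discrepancy_leD [OF disc f' f] by simp
  moreover have "\<bar>(\<integral>x. h x \<partial>\<mu>) - (\<integral>x. k x \<partial>\<mu>)\<bar> \<le> e / 2"
    by (rule close [OF real_distribution_axioms integrable_identity])
  moreover have "\<bar>(\<integral>x. h x \<partial>std_normal_distribution) - (\<integral>x. k x \<partial>std_normal_distribution)\<bar> \<le> e / 2"
    by (rule close [OF real_dist_normal_dist integrable_std_normal_identity])
  ultimately show "\<bar>(\<integral>x. h x \<partial>\<mu>) - (\<integral>x. h x \<partial>std_normal_distribution)\<bar> \<le> 8 * K + e"
    by linarith
qed

end

text \<open>Any bound on the discrepancy tests the constant function \<open>1\<close>, of Lipschitz constant \<open>0\<close>, against its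
antiderivative \<open>x\<close>. For \<open>Y\<^sub>n\<close> this gives unit variance without expanding the square of the sum.\<close>

lemma stein_discrepancy_le_variance_one:
  assumes "real_distribution \<nu>" "stein_discrepancy_le \<nu> K"
  shows "(\<integral>x. x\<^sup>2 \<partial>\<nu>) = 1"
proof -
  interpret real_distribution \<nu> by fact
  have "\<bar>(\<integral>x. 1 \<partial>\<nu>) - (\<integral>x. x * x \<partial>\<nu>)\<bar> \<le> 0 * K"
    by (rule stein_discrepancy_leD [OF assms(2)]) (auto simp: lipschitz_on_def)
  then show ?thesis
    using prob_space by (simp add: power2_eq_square)
qed

section \<open>Weighted sums and perturbations\<close>

text \<open>One factor \<open>a\<close> of the cube comes from the inner affine map and the other two from the weight \<open>a\<^sup>2\<close>, which
makes \<open>a H(s + a x)\<close> an antiderivative of \<open>a\<^sup>2 h(s + a x)\<close>.\<close>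

lemma (in standardized_law) affine_stein_discrepancy_le:
  fixes a s :: real
  assumes disc: "stein_discrepancy_le \<mu> K"
    and H: "\<And>x. (H has_real_derivative h x) (at x)" and h: "L-lipschitz_on UNIV h"
  shows "\<bar>\<integral>x. a\<^sup>2 * h (s + a * x) - a * x * H (s + a * x) \<partial>\<mu>\<bar> \<le> L * (\<bar>a\<bar> ^ 3 * K)"
proof -
  let ?h = "\<lambda>x. a\<^sup>2 * h (s + a * x)" and ?H = "\<lambda>x. a * H (s + a * x)"
  have h': "(L * \<bar>a\<bar> ^ 3)-lipschitz_on UNIV ?h"
  proof (rule lipschitz_onI)
    fix x y
    have "\<bar>?h x - ?h y\<bar> = a\<^sup>2 * \<bar>h (s + a * x) - h (s + a * y)\<bar>"
      by (simp add: abs_mult flip: right_diff_distrib)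
    also have "\<dots> \<le> a\<^sup>2 * (L * \<bar>(s + a * x) - (s + a * y)\<bar>)"
      by (intro mult_left_mono lipschitz_on_realD(1) [OF h]) auto
    also have "(s + a * x) - (s + a * y) = a * (x - y)"
      by (simp add: algebra_simps)
    also have "a\<^sup>2 * (L * \<bar>a * (x - y)\<bar>) = L * \<bar>a\<bar> ^ 3 * \<bar>x - y\<bar>"
      by (simp add: abs_mult power3_eq_cube power2_eq_square)
    finally show "dist (?h x) (?h y) \<le> L * \<bar>a\<bar> ^ 3 * dist x y"
      by (simp add: dist_real_def)
  qed (use lipschitz_on_realD(2) [OF h] in simp)
  have H': "(?H has_real_derivative ?h x) (at x)" for x
  proof -
    have "((\<lambda>x. H (s + a * x)) has_real_derivative h (s + a * x) * a) (at x)"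
      by (rule DERIV_chain2 [OF H]) (auto intro!: derivative_eq_intros)
    from DERIV_cmult [OF this, of a] show ?thesis
      by (simp add: power2_eq_square mult_ac)
  qed
  have "(\<integral>x. a\<^sup>2 * h (s + a * x) - a * x * H (s + a * x) \<partial>\<mu>) = (\<integral>x. ?h x - x * ?H x \<partial>\<mu>)"
    by (rule Bochner_Integration.integral_cong) auto
  also have "\<dots> = (\<integral>x. ?h x \<partial>\<mu>) - (\<integral>x. x * ?H x \<partial>\<mu>)"
    by (rule Bochner_Integration.integral_diff integrable_lipschitz_function
        integrable_identity_times_antiderivative h' H')+
  finally show ?thesis
    using stein_discrepancy_leD [OF disc h' H'] by (simp add: mult.assoc)
qed

text \<open>Since \<open>\<Sum> a\<^sub>i\<^sup>2 = 1\<close>, the quantity \<open>h(Y)\<close> can be distributed over the summands of \<open>Y H(Y)\<close> with weights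
\<open>a\<^sub>i\<^sup>2\<close>. In each resulting term only \<open>U\<^sub>i\<close> is integrated first, the independent rest of the sum being
a constant.\<close>

lemma (in prob_space) stein_discrepancy_weighted_sum:
  fixes U :: "'k::finite \<Rightarrow> 'a \<Rightarrow> real" and a :: "'k \<Rightarrow> real"
  assumes std: "standardized_law \<mu>" and disc: "stein_discrepancy_le \<mu> K"
    and indep: "indep_vars (\<lambda>_. borel) U UNIV"
    and law: "\<And>i. distr M borel (U i) = \<mu>"
    and a: "(\<Sum>i\<in>UNIV. (a i)\<^sup>2) = 1"
  shows "stein_discrepancy_le (distr M borel (\<lambda>\<omega>. \<Sum>i\<in>UNIV. a i * U i \<omega>)) ((\<Sum>i\<in>UNIV. \<bar>a i\<bar> ^ 3) * K)"
  unfolding stein_discrepancy_le_def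
proof (intro allI impI)
  fix H h :: "real \<Rightarrow> real" and L
  assume h: "L-lipschitz_on UNIV h" and H: "\<forall>x. (H has_real_derivative h x) (at x)"
  interpret \<mu>: standardized_law \<mu> by fact
  define Y where "Y = (\<lambda>\<omega>. \<Sum>i\<in>UNIV. a i * U i \<omega>)"
  have [measurable]: "U i \<in> borel_measurable M" for i
    using indep unfolding indep_vars_def by blast
  have H': "(H has_real_derivative h x) (at x)" for x
    using H by blast
  have [measurable]: "h \<in> borel_measurable borel"
    by (rule lipschitz_on_borel_measurable [OF h])
  have [measurable]: "H \<in> borel_measurable borel"
    by (rule deriv_imp_borel_measurable [OF H'])
  have Y [measurable]: "Y \<in> borel_measurable M"
    unfolding Y_def by measurable
  have U3: "integrable M (\<lambda>\<omega>. \<bar>U i \<omega>\<bar> ^ 3)" for i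
    by (rule integrable_if_distr [OF _ law \<mu>.third_moment]) auto
  have Y3: "integrable M (\<lambda>\<omega>. \<bar>Y \<omega>\<bar> ^ 3)"
    unfolding Y_def by (rule integrable_cube_sum) (auto simp: abs_mult power_mult_distrib U3)
  have int_h: "integrable M (\<lambda>\<omega>. h (Y \<omega>))"
    by (rule integrable_lipschitz_compose [OF Y integrable_if_cube_integrable(1) [OF Y Y3] h])
  have int_H: "integrable M (\<lambda>\<omega>. U i \<omega> * H (Y \<omega>))" for i
    by (rule integrable_times_antiderivative [OF _ U3 Y Y3 H' h]) measurable
  have summand: "\<bar>\<integral>\<omega>. (a i)\<^sup>2 * h (Y \<omega>) - a i * (U i \<omega> * H (Y \<omega>)) \<partial>M\<bar> \<le> L * (\<bar>a i\<bar> ^ 3 * K)" for i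
  proof -
    define S where "S = (\<lambda>\<omega>. \<Sum>j\<in>UNIV - {i}. a j * U j \<omega>)"
    have Y_split: "Y \<omega> = S \<omega> + a i * U i \<omega>" for \<omega>
      unfolding Y_def S_def by (subst sum.remove [of _ i]) auto
    have S [measurable]: "S \<in> borel_measurable M"
      unfolding S_def by measurable
    define Q where "Q = (\<lambda>u s. (a i)\<^sup>2 * h (s + a i * u) - a i * u * H (s + a i * u))"
    have Q_meas [measurable]: "case_prod Q \<in> borel_measurable (borel \<Otimes>\<^sub>M borel)"
      unfolding Q_def by measurable
    have indep_US: "indep_var borel (U i) borel S"
    proof -
      \<comment> \<open>Weighting only the other summands yields independence of \<open>U i\<close> itself, rather than of
        \<open>a i * U i\<close>, from \<open>S\<close>.\<close>
      have "indep_vars (\<lambda>_. borel) (\<lambda>j \<omega>. (if j = i then 1 else a j) * U j \<omega>) (insert i (UNIV - {i}))"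
        using indep by (intro indep_vars_compose2 [where Y = "\<lambda>j x. (if j = i then 1 else a j) * x" and X = U])
          (auto simp: insert_UNIV)
      from indep_vars_sum [OF _ _ this] show ?thesis
        by (simp add: S_def cong: sum.cong_simp)
    qed
    interpret S: prob_space "distr M borel S"
      by (rule prob_space_distr) measurable
    interpret P: pair_prob_space \<mu> "distr M borel S" ..
    have joint: "\<mu> \<Otimes>\<^sub>M distr M borel S = distr M (borel \<Otimes>\<^sub>M borel) (\<lambda>\<omega>. (U i \<omega>, S \<omega>))"
      using indep_US by (simp add: indep_var_distribution_eq law)
    have QSU: "Q (U i \<omega>) (S \<omega>) = (a i)\<^sup>2 * h (Y \<omega>) - a i * (U i \<omega> * H (Y \<omega>))" for \<omega>
      by (simp add: Q_def Y_split mult.assoc)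
    have int_Q: "integrable (\<mu> \<Otimes>\<^sub>M distr M borel S) (case_prod Q)"
      unfolding joint by (subst integrable_distr_eq) (use int_h int_H in \<open>auto simp: QSU\<close>)
    have "(\<integral>\<omega>. (a i)\<^sup>2 * h (Y \<omega>) - a i * (U i \<omega> * H (Y \<omega>)) \<partial>M)
        = (\<integral>p. case_prod Q p \<partial>(\<mu> \<Otimes>\<^sub>M distr M borel S))"
      unfolding joint by (subst integral_distr) (auto simp: QSU)
    also have "\<dots> = (\<integral>s. (\<integral>u. Q u s \<partial>\<mu>) \<partial>distr M borel S)"
      by (rule P.integral_snd [OF int_Q, symmetric])
    also have "\<bar>\<dots>\<bar> \<le> L * (\<bar>a i\<bar> ^ 3 * K)"
    proof (rule S.abs_integral_le_const)
      show "integrable (distr M borel S) (\<lambda>s. \<integral>u. Q u s \<partial>\<mu>)"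
        by (rule P.integrable_snd [OF int_Q])
      show "\<bar>\<integral>u. Q u s \<partial>\<mu>\<bar> \<le> L * (\<bar>a i\<bar> ^ 3 * K)" for s
        unfolding Q_def by (rule \<mu>.affine_stein_discrepancy_le [OF disc H' h])
    qed
    finally show ?thesis .
  qed
  have "(\<integral>x. h x \<partial>distr M borel Y) - (\<integral>x. x * H x \<partial>distr M borel Y)
      = (\<integral>\<omega>. h (Y \<omega>) \<partial>M) - (\<integral>\<omega>. Y \<omega> * H (Y \<omega>) \<partial>M)"
    by (simp add: integral_distr)
  also have "\<dots> = (\<integral>\<omega>. h (Y \<omega>) - Y \<omega> * H (Y \<omega>) \<partial>M)"
    using integrable_times_antiderivative [OF Y Y3 Y Y3 H' h] int_h by simp
  also have "\<dots> = (\<integral>\<omega>. (\<Sum>i\<in>UNIV. (a i)\<^sup>2 * h (Y \<omega>) - a i * (U i \<omega> * H (Y \<omega>))) \<partial>M)"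
  proof (rule Bochner_Integration.integral_cong)
    fix \<omega>
    have "(\<Sum>i\<in>UNIV. (a i)\<^sup>2 * h (Y \<omega>) - a i * (U i \<omega> * H (Y \<omega>)))
        = (\<Sum>i\<in>UNIV. (a i)\<^sup>2) * h (Y \<omega>) - (\<Sum>i\<in>UNIV. a i * U i \<omega>) * H (Y \<omega>)"
      by (simp add: sum_subtractf sum_distrib_right mult.assoc)
    then show "h (Y \<omega>) - Y \<omega> * H (Y \<omega>) = (\<Sum>i\<in>UNIV. (a i)\<^sup>2 * h (Y \<omega>) - a i * (U i \<omega> * H (Y \<omega>)))"
      unfolding a Y_def by simp
  qed simp
  also have "\<dots> = (\<Sum>i\<in>UNIV. \<integral>\<omega>. (a i)\<^sup>2 * h (Y \<omega>) - a i * (U i \<omega> * H (Y \<omega>)) \<partial>M)"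
    using int_h int_H by (intro Bochner_Integration.integral_sum) auto
  also have "\<bar>\<dots>\<bar> \<le> (\<Sum>i\<in>UNIV. L * (\<bar>a i\<bar> ^ 3 * K))"
    by (rule order_trans [OF sum_abs sum_mono]) (rule summand)
  also have "\<dots> = L * ((\<Sum>i\<in>UNIV. \<bar>a i\<bar> ^ 3) * K)"
    by (simp add: sum_distrib_left sum_distrib_right)
  finally show "\<bar>(\<integral>x. h x \<partial>distr M borel (\<lambda>\<omega>. \<Sum>i\<in>UNIV. a i * U i \<omega>))
        - (\<integral>x. x * H x \<partial>distr M borel (\<lambda>\<omega>. \<Sum>i\<in>UNIV. a i * U i \<omega>))\<bar>
      \<le> L * ((\<Sum>i\<in>UNIV. \<bar>a i\<bar> ^ 3) * K)"
    unfolding Y_def .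
qed

lemma abs_diff_cubes_le:
  fixes x y :: real
  shows "\<bar>x ^ 3 - y ^ 3\<bar> \<le> \<bar>x\<bar> ^ 3 + \<bar>y\<bar> ^ 3"
  using abs_triangle_ineq4 [of "x ^ 3" "y ^ 3"] by (simp add: power_abs)

text \<open>The normalization \<open>h(0) = H(0) = 0\<close>, under which increments of \<open>x H(x)\<close> are controlled by increments of
cubes, is available because \<open>W\<close> is standardized.\<close>

lemma (in prob_space) stein_discrepancy_perturb:
  fixes W Y :: "'a \<Rightarrow> real"
  assumes W [measurable]: "W \<in> borel_measurable M" and std: "standardized_law (distr M borel W)"
    and Y [measurable]: "Y \<in> borel_measurable M" and Y3: "integrable M (\<lambda>\<omega>. \<bar>Y \<omega>\<bar> ^ 3)"
    and disc: "stein_discrepancy_le (distr M borel Y) K"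
  shows "stein_discrepancy_le (distr M borel W)
    ((\<integral>\<omega>. \<bar>W \<omega> - Y \<omega>\<bar> \<partial>M) + 1 / 2 * (\<integral>\<omega>. \<bar>W \<omega> ^ 3 - Y \<omega> ^ 3\<bar> \<partial>M) + K)"
proof -
  interpret W: standardized_law "distr M borel W" by fact
  have W3: "integrable M (\<lambda>\<omega>. \<bar>W \<omega>\<bar> ^ 3)"
    by (rule integrable_if_distr [OF W refl W.third_moment]) auto
  note W1 = integrable_if_cube_integrable(1) [OF W W3]
    and Y1 = integrable_if_cube_integrable(1) [OF Y Y3]
  have int1: "integrable M (\<lambda>\<omega>. \<bar>W \<omega> - Y \<omega>\<bar>)"
    using W1 Y1 by simp
  have int3: "integrable M (\<lambda>\<omega>. \<bar>W \<omega> ^ 3 - Y \<omega> ^ 3\<bar>)"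
  proof (rule Bochner_Integration.integrable_bound)
    show "integrable M (\<lambda>\<omega>. \<bar>W \<omega>\<bar> ^ 3 + \<bar>Y \<omega>\<bar> ^ 3)"
      using W3 Y3 by simp
    show "AE \<omega> in M. norm \<bar>W \<omega> ^ 3 - Y \<omega> ^ 3\<bar> \<le> norm (\<bar>W \<omega>\<bar> ^ 3 + \<bar>Y \<omega>\<bar> ^ 3)"
      using abs_diff_cubes_le [of "W _" "Y _"] by (auto intro!: always_eventually)
  qed measurable
  show ?thesis
  proof (rule W.stein_discrepancy_leI)
    fix H h :: "real \<Rightarrow> real" and L
    assume h: "L-lipschitz_on UNIV h" and H: "\<And>x. (H has_real_derivative h x) (at x)"
      and zero: "h 0 = 0" "H 0 = 0"
    have [measurable]: "h \<in> borel_measurable borel"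
      by (rule lipschitz_on_borel_measurable [OF h])
    have [measurable]: "H \<in> borel_measurable borel"
      by (rule deriv_imp_borel_measurable [OF H])
    have int_hW: "integrable M (\<lambda>\<omega>. h (W \<omega>))"
      by (rule integrable_if_distr [OF W refl W.integrable_lipschitz_function [OF h]]) simp
    have int_hY: "integrable M (\<lambda>\<omega>. h (Y \<omega>))"
      by (rule integrable_lipschitz_compose [OF Y integrable_if_cube_integrable(1) [OF Y Y3] h])
    have int_HW: "integrable M (\<lambda>\<omega>. W \<omega> * H (W \<omega>))"
      by (rule integrable_times_antiderivative [OF W W3 W W3 H h])
    have int_HY: "integrable M (\<lambda>\<omega>. Y \<omega> * H (Y \<omega>))"
      by (rule integrable_times_antiderivative [OF Y Y3 Y Y3 H h])
    have "\<bar>(\<integral>\<omega>. h (W \<omega>) \<partial>M) - (\<integral>\<omega>. h (Y \<omega>) \<partial>M)\<bar> \<le> (\<integral>\<omega>. \<bar>h (W \<omega>) - h (Y \<omega>)\<bar> \<partial>M)"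
      using int_hW int_hY integral_abs_bound [of M "\<lambda>\<omega>. h (W \<omega>) - h (Y \<omega>)"] by simp
    also have "\<dots> \<le> (\<integral>\<omega>. L * \<bar>W \<omega> - Y \<omega>\<bar> \<partial>M)"
      using int_hW int_hY int1 lipschitz_on_realD(1) [OF h] by (intro integral_mono) auto
    finally have 1: "\<bar>(\<integral>\<omega>. h (W \<omega>) \<partial>M) - (\<integral>\<omega>. h (Y \<omega>) \<partial>M)\<bar> \<le> L * (\<integral>\<omega>. \<bar>W \<omega> - Y \<omega>\<bar> \<partial>M)"
      by simp
    have "\<bar>(\<integral>\<omega>. W \<omega> * H (W \<omega>) \<partial>M) - (\<integral>\<omega>. Y \<omega> * H (Y \<omega>) \<partial>M)\<bar>
        \<le> (\<integral>\<omega>. \<bar>W \<omega> * H (W \<omega>) - Y \<omega> * H (Y \<omega>)\<bar> \<partial>M)"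
      using int_HW int_HY integral_abs_bound [of M "\<lambda>\<omega>. W \<omega> * H (W \<omega>) - Y \<omega> * H (Y \<omega>)"] by simp
    also have "\<dots> \<le> (\<integral>\<omega>. L / 2 * \<bar>W \<omega> ^ 3 - Y \<omega> ^ 3\<bar> \<partial>M)"
      using int_HW int_HY int3 times_antiderivative_increment_le [OF H h zero]
      by (intro integral_mono) auto
    finally have 2: "\<bar>(\<integral>\<omega>. W \<omega> * H (W \<omega>) \<partial>M) - (\<integral>\<omega>. Y \<omega> * H (Y \<omega>) \<partial>M)\<bar>
        \<le> L / 2 * (\<integral>\<omega>. \<bar>W \<omega> ^ 3 - Y \<omega> ^ 3\<bar> \<partial>M)"
      by simp
    have 3: "\<bar>(\<integral>\<omega>. h (Y \<omega>) \<partial>M) - (\<integral>\<omega>. Y \<omega> * H (Y \<omega>) \<partial>M)\<bar> \<le> L * K"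
      using stein_discrepancy_leD [OF disc h H] by (simp add: integral_distr)
    have "\<bar>(\<integral>\<omega>. h (W \<omega>) \<partial>M) - (\<integral>\<omega>. W \<omega> * H (W \<omega>) \<partial>M)\<bar>
        \<le> L * (\<integral>\<omega>. \<bar>W \<omega> - Y \<omega>\<bar> \<partial>M) + L / 2 * (\<integral>\<omega>. \<bar>W \<omega> ^ 3 - Y \<omega> ^ 3\<bar> \<partial>M) + L * K"
      using 1 2 3 by linarith
    then show "\<bar>(\<integral>x. h x \<partial>distr M borel W) - (\<integral>x. x * H x \<partial>distr M borel W)\<bar>
        \<le> L * ((\<integral>\<omega>. \<bar>W \<omega> - Y \<omega>\<bar> \<partial>M) + 1 / 2 * (\<integral>\<omega>. \<bar>W \<omega> ^ 3 - Y \<omega> ^ 3\<bar> \<partial>M) + K)"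
      by (simp add: integral_distr algebra_simps)
  qed
qed

section \<open>Perturbations with small variance\<close>

lemma abs_diff_cubes_le_mult:
  fixes w y :: real
  shows "\<bar>w ^ 3 - y ^ 3\<bar> \<le> 3 / 2 * \<bar>(w - y) * (w\<^sup>2 + y\<^sup>2)\<bar>"
proof -
  have "\<bar>w\<^sup>2 + w * y + y\<^sup>2\<bar> \<le> 3 / 2 * (w\<^sup>2 + y\<^sup>2)"
    using sum_squares_bound [of w y] sum_squares_bound [of w "- y"]
    by (simp add: abs_le_iff algebra_simps)
  then have "\<bar>w - y\<bar> * \<bar>w\<^sup>2 + w * y + y\<^sup>2\<bar> \<le> \<bar>w - y\<bar> * (3 / 2 * (w\<^sup>2 + y\<^sup>2))"
    by (intro mult_left_mono) auto
  moreover have "w ^ 3 - y ^ 3 = (w - y) * (w\<^sup>2 + w * y + y\<^sup>2)"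
    by (simp add: algebra_simps power2_eq_square power3_eq_cube)
  ultimately show ?thesis
    by (simp add: abs_mult mult_ac)
qed

text \<open>Expanding \<open>1 = E (r Y + \<zeta>)\<^sup>2\<close> with \<open>\<bar>E Y \<zeta>\<bar> \<le> s\<close> gives \<open>(r - s)\<^sup>2 \<le> 1 \<le> (r + s)\<^sup>2\<close>, that is \<open>\<bar>r - 1\<bar> \<le> s\<close>.
Hence \<open>W - Y = (r - 1) Y + \<zeta>\<close> has \<open>L\<^sup>2\<close> norm at most \<open>2 s\<close>, and both distances follow from the
Cauchy-Schwarz inequality, the cubic one after factoring out \<open>W - Y\<close>.\<close>

lemma (in prob_space) cubic_distance_of_small_perturbation:
  fixes W Y \<zeta> :: "'a \<Rightarrow> real" and r s :: real
  assumes W: "W \<in> borel_measurable M" "integrable M (\<lambda>\<omega>. W \<omega> ^ 4)" "(\<integral>\<omega>. (W \<omega>)\<^sup>2 \<partial>M) = 1"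
    and Y: "Y \<in> borel_measurable M" "integrable M (\<lambda>\<omega>. Y \<omega> ^ 4)" "(\<integral>\<omega>. (Y \<omega>)\<^sup>2 \<partial>M) = 1"
    and split: "\<And>\<omega>. W \<omega> = r * Y \<omega> + \<zeta> \<omega>" and "0 \<le> r"
    and \<zeta>: "(\<integral>\<omega>. (\<zeta> \<omega>)\<^sup>2 \<partial>M) = s\<^sup>2" and "0 \<le> s"
  shows "(\<integral>\<omega>. \<bar>W \<omega> - Y \<omega>\<bar> \<partial>M) + 1 / 2 * (\<integral>\<omega>. \<bar>W \<omega> ^ 3 - Y \<omega> ^ 3\<bar> \<partial>M)
    \<le> s * (2 + 3 / 2 * sqrt (2 * ((\<integral>\<omega>. W \<omega> ^ 4 \<partial>M) + (\<integral>\<omega>. Y \<omega> ^ 4 \<partial>M))))"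
proof -
  note [measurable] = W(1) Y(1)
  have W2: "integrable M (\<lambda>\<omega>. (W \<omega>)\<^sup>2)" and Y2: "integrable M (\<lambda>\<omega>. (Y \<omega>)\<^sup>2)"
    using integrable_square_if_fourth W Y by blast+
  have WY: "integrable M (\<lambda>\<omega>. W \<omega> * Y \<omega>)"
    using integral_abs_mult_le(1) W2 Y2 W(1) Y(1) by blast
  have \<zeta>_eq: "\<zeta> = (\<lambda>\<omega>. W \<omega> - r * Y \<omega>)"
    using split by (simp add: fun_eq_iff)
  have \<zeta>_meas [measurable]: "\<zeta> \<in> borel_measurable M"
    unfolding \<zeta>_eq by measurable
  have \<zeta>2: "integrable M (\<lambda>\<omega>. (\<zeta> \<omega>)\<^sup>2)"
  proof -
    have "integrable M (\<lambda>\<omega>. (W \<omega>)\<^sup>2 - 2 * r * (W \<omega> * Y \<omega>) + r\<^sup>2 * (Y \<omega>)\<^sup>2)"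
      using W2 Y2 WY by simp
    then show ?thesis
      by (simp add: \<zeta>_eq power2_diff power_mult_distrib algebra_simps)
  qed
  have Y\<zeta>: "integrable M (\<lambda>\<omega>. Y \<omega> * \<zeta> \<omega>)" "(\<integral>\<omega>. \<bar>Y \<omega> * \<zeta> \<omega>\<bar> \<partial>M) \<le> s"
    using integral_abs_mult_le [OF Y(1) Y2 \<zeta>_meas \<zeta>2] Y(3) \<zeta> \<open>0 \<le> s\<close> by simp_all
  have cov: "\<bar>\<integral>\<omega>. Y \<omega> * \<zeta> \<omega> \<partial>M\<bar> \<le> s"
    using integral_abs_bound [of M "\<lambda>\<omega>. Y \<omega> * \<zeta> \<omega>"] Y\<zeta>(2) by linarith
  have "1 = (\<integral>\<omega>. r\<^sup>2 * (Y \<omega>)\<^sup>2 + 2 * r * (Y \<omega> * \<zeta> \<omega>) + (\<zeta> \<omega>)\<^sup>2 \<partial>M)"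
    unfolding W(3) [symmetric]
    by (rule Bochner_Integration.integral_cong) (auto simp: split power2_sum power_mult_distrib)
  also have "\<dots> = r\<^sup>2 + 2 * r * (\<integral>\<omega>. Y \<omega> * \<zeta> \<omega> \<partial>M) + s\<^sup>2"
    using Y2 Y\<zeta>(1) \<zeta>2 by (simp add: Y(3) \<zeta>)
  finally have one: "1 = r\<^sup>2 + 2 * r * (\<integral>\<omega>. Y \<omega> * \<zeta> \<omega> \<partial>M) + s\<^sup>2" .
  have "\<bar>r * (\<integral>\<omega>. Y \<omega> * \<zeta> \<omega> \<partial>M)\<bar> \<le> r * s"
    using cov \<open>0 \<le> r\<close> by (simp add: abs_mult mult_left_mono)
  with one have "(r - s)\<^sup>2 \<le> 1\<^sup>2" "1\<^sup>2 \<le> (r + s)\<^sup>2"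
    by (simp_all add: power2_sum power2_diff abs_le_iff)
  then have "\<bar>r - s\<bar> \<le> \<bar>1\<bar>" "\<bar>1\<bar> \<le> \<bar>r + s\<bar>"
    by (simp_all only: abs_le_square_iff)
  then have r: "\<bar>r - 1\<bar> \<le> s"
    using \<open>0 \<le> r\<close> \<open>0 \<le> s\<close> by linarith
  have D2: "integrable M (\<lambda>\<omega>. (W \<omega> - Y \<omega>)\<^sup>2)"
    using W2 Y2 WY by (simp add: power2_diff mult.assoc)
  have "(\<integral>\<omega>. (W \<omega> - Y \<omega>)\<^sup>2 \<partial>M) \<le> (\<integral>\<omega>. 2 * (r - 1)\<^sup>2 * (Y \<omega>)\<^sup>2 + 2 * (\<zeta> \<omega>)\<^sup>2 \<partial>M)"
  proof (rule integral_mono)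
    fix \<omega>
    have "W \<omega> - Y \<omega> = (r - 1) * Y \<omega> + \<zeta> \<omega>"
      by (simp add: split algebra_simps)
    then have "(W \<omega> - Y \<omega>)\<^sup>2 \<le> 2 * ((r - 1) * Y \<omega>)\<^sup>2 + 2 * (\<zeta> \<omega>)\<^sup>2"
      using sum_squares_bound [of "(r - 1) * Y \<omega>" "\<zeta> \<omega>"] by (simp add: power2_sum)
    then show "(W \<omega> - Y \<omega>)\<^sup>2 \<le> 2 * (r - 1)\<^sup>2 * (Y \<omega>)\<^sup>2 + 2 * (\<zeta> \<omega>)\<^sup>2"
      by (simp add: power_mult_distrib)
  qed (use D2 Y2 \<zeta>2 in auto)
  also have "\<dots> = 2 * (r - 1)\<^sup>2 + 2 * s\<^sup>2"
    using Y2 \<zeta>2 by (simp add: Y(3) \<zeta>)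
  also have "\<dots> \<le> (2 * s)\<^sup>2"
    using r \<open>0 \<le> s\<close> abs_le_square_iff [of "r - 1" s] by (simp add: power_mult_distrib)
  finally have D: "sqrt (\<integral>\<omega>. (W \<omega> - Y \<omega>)\<^sup>2 \<partial>M) \<le> 2 * s"
    using \<open>0 \<le> s\<close> by (intro real_le_lsqrt) auto
  have first: "(\<integral>\<omega>. \<bar>W \<omega> - Y \<omega>\<bar> \<partial>M) \<le> 2 * s"
    using integral_abs_mult_le(2) [of "\<lambda>\<omega>. W \<omega> - Y \<omega>" M "\<lambda>_. 1"] D2 D prob_space by simp
  have Q: "integrable M (\<lambda>\<omega>. ((W \<omega>)\<^sup>2 + (Y \<omega>)\<^sup>2)\<^sup>2)"
    and Q_le: "(\<integral>\<omega>. ((W \<omega>)\<^sup>2 + (Y \<omega>)\<^sup>2)\<^sup>2 \<partial>M) \<le> 2 * ((\<integral>\<omega>. W \<omega> ^ 4 \<partial>M) + (\<integral>\<omega>. Y \<omega> ^ 4 \<partial>M))"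
  proof -
    have le: "((W \<omega>)\<^sup>2 + (Y \<omega>)\<^sup>2)\<^sup>2 \<le> 2 * (W \<omega> ^ 4 + Y \<omega> ^ 4)" for \<omega>
      using sum_squares_bound [of "(W \<omega>)\<^sup>2" "(Y \<omega>)\<^sup>2"] by (simp add: power2_sum)
    have dom: "integrable M (\<lambda>\<omega>. 2 * (W \<omega> ^ 4 + Y \<omega> ^ 4))"
      using W Y by simp
    show Q: "integrable M (\<lambda>\<omega>. ((W \<omega>)\<^sup>2 + (Y \<omega>)\<^sup>2)\<^sup>2)"
      by (rule Bochner_Integration.integrable_bound [OF dom]) (use le in \<open>auto intro!: always_eventually\<close>)
    show "(\<integral>\<omega>. ((W \<omega>)\<^sup>2 + (Y \<omega>)\<^sup>2)\<^sup>2 \<partial>M) \<le> 2 * ((\<integral>\<omega>. W \<omega> ^ 4 \<partial>M) + (\<integral>\<omega>. Y \<omega> ^ 4 \<partial>M))"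
      using integral_mono [OF Q dom le] W Y by simp
  qed
  have prod: "integrable M (\<lambda>\<omega>. (W \<omega> - Y \<omega>) * ((W \<omega>)\<^sup>2 + (Y \<omega>)\<^sup>2))"
    "(\<integral>\<omega>. \<bar>(W \<omega> - Y \<omega>) * ((W \<omega>)\<^sup>2 + (Y \<omega>)\<^sup>2)\<bar> \<partial>M)
      \<le> sqrt (\<integral>\<omega>. (W \<omega> - Y \<omega>)\<^sup>2 \<partial>M) * sqrt (\<integral>\<omega>. ((W \<omega>)\<^sup>2 + (Y \<omega>)\<^sup>2)\<^sup>2 \<partial>M)"
    by (rule integral_abs_mult_le; use D2 Q in simp)+
  have "(\<integral>\<omega>. \<bar>W \<omega> ^ 3 - Y \<omega> ^ 3\<bar> \<partial>M) \<le> (\<integral>\<omega>. 3 / 2 * \<bar>(W \<omega> - Y \<omega>) * ((W \<omega>)\<^sup>2 + (Y \<omega>)\<^sup>2)\<bar> \<partial>M)"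
  proof (rule integral_mono)
    show "integrable M (\<lambda>\<omega>. \<bar>W \<omega> ^ 3 - Y \<omega> ^ 3\<bar>)"
      by (rule Bochner_Integration.integrable_bound
          [where f = "\<lambda>\<omega>. 3 / 2 * \<bar>(W \<omega> - Y \<omega>) * ((W \<omega>)\<^sup>2 + (Y \<omega>)\<^sup>2)\<bar>"])
         (use prod(1) abs_diff_cubes_le_mult in \<open>auto intro!: always_eventually\<close>)
  qed (use prod(1) abs_diff_cubes_le_mult in auto)
  also have "\<dots> \<le> 3 / 2 * (2 * s * sqrt (2 * ((\<integral>\<omega>. W \<omega> ^ 4 \<partial>M) + (\<integral>\<omega>. Y \<omega> ^ 4 \<partial>M))))"
  proof -
    have "sqrt (\<integral>\<omega>. (W \<omega> - Y \<omega>)\<^sup>2 \<partial>M) * sqrt (\<integral>\<omega>. ((W \<omega>)\<^sup>2 + (Y \<omega>)\<^sup>2)\<^sup>2 \<partial>M)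
      \<le> 2 * s * sqrt (2 * ((\<integral>\<omega>. W \<omega> ^ 4 \<partial>M) + (\<integral>\<omega>. Y \<omega> ^ 4 \<partial>M)))"
      using D Q_le \<open>0 \<le> s\<close> by (intro mult_mono) auto
    with prod(2) show ?thesis
      by simp
  qed
  finally show ?thesis
    using first by (simp add: algebra_simps)
qed

lemma (in prob_space) fourth_central_moment_bound:
  fixes X :: "'a \<Rightarrow> real"
  assumes X: "X \<in> borel_measurable M" and b: "fourth_central_moment M X \<le> ennreal b" "0 \<le> b"
  shows "integrable M (\<lambda>\<omega>. (X \<omega> - expectation X) ^ 4)"
    and "(\<integral>\<omega>. (X \<omega> - expectation X) ^ 4 \<partial>M) \<le> b"
proof -
  show int: "integrable M (\<lambda>\<omega>. (X \<omega> - expectation X) ^ 4)"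
  proof (rule integrableI_nonneg)
    show "(\<integral>\<^sup>+ \<omega>. ennreal ((X \<omega> - expectation X) ^ 4) \<partial>M) < \<infinity>"
      using b(1) unfolding fourth_central_moment_def by (rule le_less_trans) simp
  qed (use X in auto)
  have "ennreal (\<integral>\<omega>. (X \<omega> - expectation X) ^ 4 \<partial>M) \<le> ennreal b"
    using b(1) unfolding fourth_central_moment_def by (subst (asm) nn_integral_eq_integral [OF int]) auto
  then show "(\<integral>\<omega>. (X \<omega> - expectation X) ^ 4 \<partial>M) \<le> b"
    using b(2) by (simp add: ennreal_le_iff)
qed

text \<open>Two applications of the Cauchy-Schwarz inequality for finite sums bound the fourth power of
\<open>\<Sum> a\<^sub>i U\<^sub>i\<close> by \<open>k \<Sum> U\<^sub>i\<^sup>4\<close>, where \<open>k\<close> is the number of summands.\<close>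

lemma (in prob_space) fourth_moment_normalized_sum_le:
  fixes U :: "'k::finite \<Rightarrow> 'a \<Rightarrow> real" and a :: "'k \<Rightarrow> real"
  assumes U: "\<And>i. U i \<in> borel_measurable M" "\<And>i. integrable M (\<lambda>\<omega>. U i \<omega> ^ 4)"
    "\<And>i. (\<integral>\<omega>. U i \<omega> ^ 4 \<partial>M) = m"
    and a: "(\<Sum>i\<in>UNIV. (a i)\<^sup>2) = 1"
  shows "integrable M (\<lambda>\<omega>. (\<Sum>i\<in>UNIV. a i * U i \<omega>) ^ 4)"
    and "(\<integral>\<omega>. (\<Sum>i\<in>UNIV. a i * U i \<omega>) ^ 4 \<partial>M) \<le> (real CARD('k))\<^sup>2 * m"
proof -
  let ?B = "\<lambda>\<omega>. real CARD('k) * (\<Sum>i\<in>UNIV. U i \<omega> ^ 4)"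
  note [measurable] = U(1)
  have le: "(\<Sum>i\<in>UNIV. a i * U i \<omega>) ^ 4 \<le> ?B \<omega>" for \<omega>
  proof -
    have "(\<Sum>i\<in>UNIV. a i * U i \<omega>)\<^sup>2 \<le> (\<Sum>i\<in>UNIV. (U i \<omega>)\<^sup>2)"
      using Cauchy_Schwarz_ineq_sum [of a "\<lambda>i. U i \<omega>" UNIV] by (simp add: a)
    then have "((\<Sum>i\<in>UNIV. a i * U i \<omega>)\<^sup>2)\<^sup>2 \<le> (\<Sum>i\<in>UNIV. (U i \<omega>)\<^sup>2)\<^sup>2"
      by (rule power_mono) simp
    also have "\<dots> \<le> real CARD('k) * (\<Sum>i\<in>UNIV. ((U i \<omega>)\<^sup>2)\<^sup>2)"
      using Cauchy_Schwarz_ineq_sum [of "\<lambda>_. 1" "\<lambda>i. (U i \<omega>)\<^sup>2" "UNIV :: 'k set"] by simp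
    finally show ?thesis
      by simp
  qed
  have dom: "integrable M ?B"
    using U(2) by simp
  show int: "integrable M (\<lambda>\<omega>. (\<Sum>i\<in>UNIV. a i * U i \<omega>) ^ 4)"
    by (rule Bochner_Integration.integrable_bound [OF dom])
       (use le order_trans [OF le abs_ge_self] in \<open>auto intro!: always_eventually\<close>)
  have "(\<integral>\<omega>. (\<Sum>i\<in>UNIV. a i * U i \<omega>) ^ 4 \<partial>M) \<le> (\<integral>\<omega>. ?B \<omega> \<partial>M)"
    by (rule integral_mono [OF int dom le])
  also have "\<dots> = (real CARD('k))\<^sup>2 * m"
    using U by (simp add: power2_eq_square)
  finally show "(\<integral>\<omega>. (\<Sum>i\<in>UNIV. a i * U i \<omega>) ^ 4 \<partial>M) \<le> (real CARD('k))\<^sup>2 * m" .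
qed

lemma power_scaled_product:
  fixes C x y :: real
  shows "(C * (x * y) ^ n) ^ k = C ^ k * x ^ (k * n) * y ^ (k * n)"
  by (simp only: power_mult_distrib power_mult [symmetric] mult.commute [of k n] mult.assoc)

lemma scaled_power_quotient:
  fixes C D l x y :: real
  assumes "l \<noteq> 0" "y \<noteq> 0"
  shows "(C * (l * x) ^ n) / (D * (l * y) ^ n) = C / D * (x / y) ^ n"
  using assms by (simp add: power_mult_distrib power_divide)

section \<open>Recursive inequalities and the contraction factor\<close>

text \<open>The constant dominates \<open>K m / \<gamma>\<^sup>m\<close> for the finitely many initial indices and satisfies
\<open>\<bar>B\<bar> + \<psi> C \<le> C \<gamma>\<close>, which makes the bound reproduce itself from then on.\<close>

lemma geometric_bound_of_recursion:
  fixes K b p :: "nat \<Rightarrow> real"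
  assumes rec: "\<And>n. K (Suc n) \<le> b n + p n * K n" and nonneg: "\<And>n. 0 \<le> K n"
    and b: "eventually (\<lambda>n. b n \<le> B * \<gamma> ^ n) sequentially"
    and p: "eventually (\<lambda>n. p n \<le> \<psi>) sequentially"
    and "0 < \<gamma>" "0 \<le> \<psi>" "\<psi> < \<gamma>"
  obtains C where "\<And>n. K n \<le> C * \<gamma> ^ n"
proof -
  from eventually_conj [OF b p] obtain N where N: "\<And>n. N \<le> n \<Longrightarrow> b n \<le> B * \<gamma> ^ n \<and> p n \<le> \<psi>"
    unfolding eventually_sequentially by blast
  define C where "C = (\<Sum>m\<le>N. K m / \<gamma> ^ m) + \<bar>B\<bar> / (\<gamma> - \<psi>)"
  have sum_nonneg: "0 \<le> (\<Sum>m\<le>N. K m / \<gamma> ^ m)"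
    using nonneg \<open>0 < \<gamma>\<close> by (intro sum_nonneg) simp
  have C0: "0 \<le> C"
    using sum_nonneg \<open>\<psi> < \<gamma>\<close> by (simp add: C_def)
  have "\<bar>B\<bar> / (\<gamma> - \<psi>) \<le> C"
    using sum_nonneg by (simp add: C_def)
  then have C1: "\<bar>B\<bar> + \<psi> * C \<le> C * \<gamma>"
    using \<open>\<psi> < \<gamma>\<close> by (simp add: field_simps)
  have "K n \<le> C * \<gamma> ^ n" for n
  proof (cases "n \<le> N")
    case True
    have "K n / \<gamma> ^ n \<le> (\<Sum>m\<le>N. K m / \<gamma> ^ m)"
      by (rule member_le_sum) (use True nonneg \<open>0 < \<gamma>\<close> in auto)
    also have "\<dots> \<le> C"
      using \<open>\<psi> < \<gamma>\<close> by (simp add: C_def)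
    finally show ?thesis
      using \<open>0 < \<gamma>\<close> by (simp add: field_simps)
  next
    case False
    then have "N \<le> n" by simp
    then show ?thesis
    proof (induction rule: dec_induct)
      case base
      have "K N / \<gamma> ^ N \<le> (\<Sum>m\<le>N. K m / \<gamma> ^ m)"
        by (rule member_le_sum) (use nonneg \<open>0 < \<gamma>\<close> in auto)
      also have "\<dots> \<le> C"
        using \<open>\<psi> < \<gamma>\<close> by (simp add: C_def)
      finally show ?case
        using \<open>0 < \<gamma>\<close> by (simp add: field_simps)
    next
      case (step m)
      have "K (Suc m) \<le> b m + p m * K m"
        by (rule rec)
      also have "\<dots> \<le> \<bar>B\<bar> * \<gamma> ^ m + \<psi> * (C * \<gamma> ^ m)"
      proof (rule add_mono)
        have "b m \<le> B * \<gamma> ^ m"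
          using N step by blast
        also have "\<dots> \<le> \<bar>B\<bar> * \<gamma> ^ m"
          using \<open>0 < \<gamma>\<close> by (intro mult_right_mono) auto
        finally show "b m \<le> \<bar>B\<bar> * \<gamma> ^ m" .
        have "p m * K m \<le> \<psi> * K m"
          using N step nonneg by (intro mult_right_mono) auto
        also have "\<dots> \<le> \<psi> * (C * \<gamma> ^ m)"
          using step \<open>0 \<le> \<psi>\<close> by (intro mult_left_mono) auto
        finally show "p m * K m \<le> \<psi> * (C * \<gamma> ^ m)" .
      qed
      also have "\<dots> = (\<bar>B\<bar> + \<psi> * C) * \<gamma> ^ m"
        by (simp add: algebra_simps)
      also have "\<dots> \<le> C * \<gamma> * \<gamma> ^ m"
        using C1 \<open>0 < \<gamma>\<close> by (intro mult_right_mono) auto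
      finally show ?case
        by (simp add: mult_ac)
    qed
  qed
  then show ?thesis
    by (rule that)
qed

lemma phi_vec_eq_sum_cubes: "phi_vec v = (\<Sum>i\<in>UNIV. \<bar>v $ i / norm v\<bar> ^ 3)"
  by (simp add: phi_vec_def sum_divide_distrib power_divide)

lemma norm_square_eq_sum: "(norm v)\<^sup>2 = (\<Sum>i\<in>UNIV. (v $ i)\<^sup>2)" for v :: "real ^ 'k"
  unfolding power2_norm_eq_inner by (simp add: inner_vec_def power2_eq_square)

lemma sum_normalized_squares:
  fixes v :: "real ^ 'k"
  assumes "norm v \<noteq> 0"
  shows "(\<Sum>i\<in>UNIV. (v $ i / norm v)\<^sup>2) = 1"
  using assms by (simp add: power_divide norm_square_eq_sum [symmetric] flip: sum_divide_distrib)

lemma phi_vec_nonneg: "0 \<le> phi_vec v"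
  by (simp add: phi_vec_def sum_nonneg)

text \<open>The normalized entries \<open>b\<^sub>i\<close> satisfy \<open>\<Sum> b\<^sub>i\<^sup>2 = 1\<close>. If some \<open>b\<^sub>i\<close> were \<open>1\<close>, all others would vanish and the
vector would be a multiple of a basis vector. So all \<open>b\<^sub>i\<close> are below \<open>1\<close>, and cubing instead of squaring
strictly decreases the sum.\<close>

lemma phi_vec_less_one:
  fixes a :: "real ^ 'k"
  assumes "\<forall>c i. a \<noteq> c *\<^sub>R axis i 1"
  shows "phi_vec a < 1"
proof -
  have "a \<noteq> 0"
    using assms [rule_format, of 0 undefined] by simp
  then have norm: "norm a \<noteq> 0" and "0 < norm a"
    by auto
  define b where "b i = \<bar>a $ i / norm a\<bar>" for i
  have b_sum: "(\<Sum>i\<in>UNIV. (b i)\<^sup>2) = 1"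
    using sum_normalized_squares [OF norm] by (simp add: b_def power_divide)
  have b_nonneg: "0 \<le> b i" for i
    by (simp add: b_def)
  have b_less: "b i < 1" for i
  proof (rule ccontr)
    assume "\<not> b i < 1"
    then have bi: "1 \<le> (b i)\<^sup>2"
      by simp
    have "(\<Sum>j\<in>UNIV - {i}. (b j)\<^sup>2) = 1 - (b i)\<^sup>2"
      using b_sum by (subst (asm) sum.remove [of _ i]) auto
    with bi have "(\<Sum>j\<in>UNIV - {i}. (b j)\<^sup>2) = 0"
      using sum_nonneg [of "UNIV - {i}" "\<lambda>j. (b j)\<^sup>2"] by simp
    then have "b j = 0" if "j \<noteq> i" for j
      using that by (subst (asm) sum_nonneg_eq_0_iff) auto
    then have "a = (a $ i) *\<^sub>R axis i 1"
      using norm by (auto simp: vec_eq_iff axis_def b_def)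
    with assms show False
      by blast
  qed
  obtain i where i: "a $ i \<noteq> 0"
    using \<open>a \<noteq> 0\<close> by (auto simp: vec_eq_iff)
  have "phi_vec a = (\<Sum>i\<in>UNIV. b i ^ 3)"
    by (simp add: phi_vec_eq_sum_cubes b_def)
  also have "\<dots> < (\<Sum>i\<in>UNIV. (b i)\<^sup>2)"
  proof (rule sum_strict_mono_ex1)
    show "\<forall>i\<in>UNIV. b i ^ 3 \<le> (b i)\<^sup>2"
      using b_nonneg b_less by (intro ballI power_decreasing) (auto intro: less_imp_le)
    have "0 < b i"
      using i norm by (simp add: b_def)
    then have "b i ^ 3 < (b i)\<^sup>2"
      using b_less by (intro power_strict_decreasing) auto
    then show "\<exists>i\<in>UNIV. b i ^ 3 < (b i)\<^sup>2"
      by blast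
  qed simp
  finally show ?thesis
    using b_sum by simp
qed

lemma tendsto_phi_vec:
  fixes a :: "real ^ 'k"
  assumes "(f \<longlongrightarrow> a) F" "a \<noteq> 0"
  shows "((\<lambda>n. phi_vec (f n)) \<longlongrightarrow> phi_vec a) F"
  unfolding phi_vec_def
  by (intro tendsto_intros assms) (use assms(2) in auto)

lemma condition_A_nonzero:
  assumes "condition_A \<alpha> M X Z a \<delta>\<^sub>1 \<delta>\<^sub>2"
  shows "a \<noteq> 0"
proof
  assume "a = 0"
  moreover have "a \<noteq> 0 *\<^sub>R axis undefined 1"
    using assms unfolding condition_A_def by blast
  ultimately show False
    by simp
qed

section \<open>Hierarchical sequences\<close>

text \<open>The locale fixes the data of the recursion. Only the laws of the standardized variables enter the
recursion for the discrepancies, so the probability spaces of consecutive steps are linked by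
\<open>W_next_law\<close> alone.\<close>

locale hierarchical =
  fixes \<alpha> :: "nat \<Rightarrow> real ^ 'k" and M :: "nat \<Rightarrow> 'a measure"
    and X :: "nat \<Rightarrow> 'a \<Rightarrow> real" and V :: "nat \<Rightarrow> 'a \<Rightarrow> real ^ 'k" and Z :: "nat \<Rightarrow> 'a \<Rightarrow> real"
  assumes hierarchical: "hierarchical_sequence \<alpha> M X V Z"
begin

abbreviation c :: "nat \<Rightarrow> real" where "c n \<equiv> prob_space.expectation (M n) (X n)"
abbreviation \<sigma> :: "nat \<Rightarrow> real" where "\<sigma> n \<equiv> std_dev (M n) (X n)"
abbreviation W_law :: "nat \<Rightarrow> real measure" where "W_law n \<equiv> distr (M n) borel (W_seq M X n)"

lemma prob_space_M: "prob_space (M n)"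
  and \<alpha>_nz: "norm (\<alpha> n) \<noteq> 0"
  and X_meas: "X n \<in> borel_measurable (M n)"
  and Z_meas: "Z n \<in> borel_measurable (M n)"
  and X_square_integrable: "integrable (M n) (\<lambda>\<omega>. (X n \<omega>)\<^sup>2)"
  and X_variance_nz: "prob_space.variance (M n) (X n) \<noteq> 0"
  and V_indep: "prob_space.indep_vars (M n) (\<lambda>_. borel) (\<lambda>i \<omega>. V n \<omega> $ i) UNIV"
  and V_law: "distr (M n) borel (\<lambda>\<omega>. V n \<omega> $ i) = distr (M n) borel (X n)"
  and X_Suc_law: "distr (M (Suc n)) borel (X (Suc n)) = distr (M n) borel (\<lambda>\<omega>. \<alpha> n \<bullet> V n \<omega> + Z n \<omega>)"
  using hierarchical unfolding hierarchical_sequence_def by blast+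

lemma V_meas: "(\<lambda>\<omega>. V n \<omega> $ i) \<in> borel_measurable (M n)"
  using V_indep [of n] unfolding prob_space.indep_vars_def [OF prob_space_M] by blast

lemma \<alpha>V_meas: "(\<lambda>\<omega>. \<alpha> n \<bullet> V n \<omega>) \<in> borel_measurable (M n)"
  unfolding inner_vec_def using V_meas by (intro borel_measurable_sum) (simp add: borel_measurable_times)

lemma X_integrable: "integrable (M n) (X n)"
proof -
  interpret prob_space "M n" by (rule prob_space_M)
  show ?thesis
    using square_integrable_imp_integrable [OF X_meas X_square_integrable] .
qed

lemma \<sigma>_pos: "0 < \<sigma> n" and \<sigma>_square: "(\<sigma> n)\<^sup>2 = prob_space.variance (M n) (X n)"
proof -
  interpret prob_space "M n" by (rule prob_space_M)
  have "0 < variance (X n)"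
    using variance_positive [of "X n"] X_variance_nz [of n] by linarith
  then show "0 < \<sigma> n" "(\<sigma> n)\<^sup>2 = variance (X n)"
    by (simp_all add: std_dev_def)
qed

lemma W_seq_eq: "W_seq M X n = (\<lambda>\<omega>. (X n \<omega> - c n) / \<sigma> n)"
  by (simp add: W_seq_def fun_eq_iff)

lemma W_meas: "W_seq M X n \<in> borel_measurable (M n)"
  unfolding W_seq_eq using X_meas by simp

lemma Y_seq_eq: "Y_seq \<alpha> M X V n
    = (\<lambda>\<omega>. \<Sum>i\<in>UNIV. \<alpha> n $ i / norm (\<alpha> n) * ((V n \<omega> $ i - c n) / \<sigma> n))"
  by (simp add: Y_seq_def fun_eq_iff)

lemma Y_meas: "Y_seq \<alpha> M X V n \<in> borel_measurable (M n)"
  unfolding Y_seq_eq using V_meas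
  by (intro borel_measurable_sum borel_measurable_times borel_measurable_divide borel_measurable_diff) auto

lemma W_next_meas: "W_next \<alpha> M X V Z n \<in> borel_measurable (M n)"
  unfolding W_next_def [abs_def] using \<alpha>V_meas [of n] Z_meas [of n] by simp

lemma W_next_law: "distr (M n) borel (W_next \<alpha> M X V Z n) = W_law (Suc n)"
proof -
  let ?s = "\<lambda>x. (x - c (Suc n)) / \<sigma> (Suc n)"
  have "distr (M n) borel (W_next \<alpha> M X V Z n)
      = distr (distr (M n) borel (\<lambda>\<omega>. \<alpha> n \<bullet> V n \<omega> + Z n \<omega>)) borel ?s"
    using \<alpha>V_meas [of n] Z_meas [of n]
    by (subst distr_distr) (auto simp: W_next_def [abs_def] comp_def)
  also have "\<dots> = W_law (Suc n)"
    unfolding X_Suc_law [symmetric] using X_meas [of "Suc n"]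
    by (subst distr_distr) (auto simp: W_seq_eq comp_def)
  finally show ?thesis .
qed

lemma V_standardized_law: "distr (M n) borel (\<lambda>\<omega>. (V n \<omega> $ i - c n) / \<sigma> n) = W_law n"
proof -
  let ?s = "\<lambda>x. (x - c n) / \<sigma> n"
  have "distr (M n) borel (\<lambda>\<omega>. (V n \<omega> $ i - c n) / \<sigma> n) = distr (distr (M n) borel (\<lambda>\<omega>. V n \<omega> $ i)) borel ?s"
    using V_meas [of n i] by (subst distr_distr) (auto simp: comp_def)
  also have "\<dots> = W_law n"
    unfolding V_law using X_meas [of n] by (subst distr_distr) (auto simp: W_seq_eq comp_def)
  finally show ?thesis .
qed

lemma V_standardized_indep:
  "prob_space.indep_vars (M n) (\<lambda>_. borel) (\<lambda>i \<omega>. (V n \<omega> $ i - c n) / \<sigma> n) UNIV"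
  by (rule prob_space.indep_vars_compose2 [OF prob_space_M V_indep]) simp

context
  assumes third: "\<And>n. integrable (M n) (\<lambda>\<omega>. \<bar>X n \<omega>\<bar> ^ 3)"
begin

lemma W_third_moment: "integrable (M n) (\<lambda>\<omega>. \<bar>W_seq M X n \<omega>\<bar> ^ 3)"
proof -
  interpret prob_space "M n" by (rule prob_space_M)
  have "integrable (M n) (\<lambda>\<omega>. \<bar>X n \<omega> + (- c n)\<bar> ^ 3 / (\<sigma> n) ^ 3)"
    using third [of n] X_meas [of n] by (intro integrable_divide_zero integrable_cube_add) auto
  then show ?thesis
    using \<sigma>_pos [of n] by (simp add: W_seq_eq power_divide)
qed

lemma W_law_standardized: "standardized_law (W_law n)"
proof -
  interpret prob_space "M n" by (rule prob_space_M)
  note [measurable] = W_meas [of n]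
  interpret D: real_distribution "W_law n"
    by (rule real_distribution_distr) simp
  show ?thesis
  proof
    show "integrable (W_law n) (\<lambda>x. \<bar>x\<bar> ^ 3)"
      using W_third_moment [of n] by (simp add: integrable_distr_eq)
    have "(\<integral>x. x \<partial>W_law n) = (\<integral>\<omega>. W_seq M X n \<omega> \<partial>M n)"
      by (subst integral_distr) simp_all
    also have "\<dots> = 0"
      unfolding W_seq_eq using X_integrable [of n] prob_space by simp
    finally show "(\<integral>x. x \<partial>W_law n) = 0" .
    have "(\<integral>x. x\<^sup>2 \<partial>W_law n) = (\<integral>\<omega>. (X n \<omega> - c n)\<^sup>2 / (\<sigma> n)\<^sup>2 \<partial>M n)"
      by (subst integral_distr) (use W_meas [of n] in \<open>simp_all add: W_seq_eq power_divide\<close>)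
    also have "\<dots> = variance (X n) / (\<sigma> n)\<^sup>2"
      by simp
    also have "\<dots> = 1"
      using \<sigma>_pos [of n] by (simp add: \<sigma>_square [symmetric])
    finally show "(\<integral>x. x\<^sup>2 \<partial>W_law n) = 1" .
  qed
qed

lemma Y_third_moment: "integrable (M n) (\<lambda>\<omega>. \<bar>Y_seq \<alpha> M X V n \<omega>\<bar> ^ 3)"
  unfolding Y_seq_eq
proof (rule integrable_cube_sum)
  interpret prob_space "M n" by (rule prob_space_M)
  interpret D: standardized_law "W_law n" by (rule W_law_standardized)
  fix i
  have meas: "(\<lambda>\<omega>. (V n \<omega> $ i - c n) / \<sigma> n) \<in> borel_measurable (M n)"
    using V_meas [of n i] by simp
  then show "(\<lambda>\<omega>. \<alpha> n $ i / norm (\<alpha> n) * ((V n \<omega> $ i - c n) / \<sigma> n)) \<in> borel_measurable (M n)"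
    by (rule borel_measurable_times [OF borel_measurable_const])
  have "integrable (M n) (\<lambda>\<omega>. \<bar>(V n \<omega> $ i - c n) / \<sigma> n\<bar> ^ 3)"
    by (rule integrable_if_distr [OF meas V_standardized_law D.third_moment]) simp
  then show "integrable (M n) (\<lambda>\<omega>. \<bar>\<alpha> n $ i / norm (\<alpha> n) * ((V n \<omega> $ i - c n) / \<sigma> n)\<bar> ^ 3)"
    unfolding abs_mult power_mult_distrib by (rule integrable_mult_right)
qed simp

lemma Y_stein_discrepancy:
  assumes "stein_discrepancy_le (W_law n) K"
  shows "stein_discrepancy_le (distr (M n) borel (Y_seq \<alpha> M X V n)) (phi_vec (\<alpha> n) * K)"
  unfolding Y_seq_eq phi_vec_eq_sum_cubes
  by (rule prob_space.stein_discrepancy_weighted_sum [OF prob_space_M W_law_standardized assms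
        V_standardized_indep V_standardized_law sum_normalized_squares [OF \<alpha>_nz]])

lemma W_stein_discrepancy_step:
  assumes "stein_discrepancy_le (W_law n) K"
  shows "stein_discrepancy_le (W_law (Suc n)) (beta_seq \<alpha> M X V Z n + phi_vec (\<alpha> n) * K)"
proof -
  interpret prob_space "M n" by (rule prob_space_M)
  show ?thesis
    using stein_discrepancy_perturb [OF W_next_meas _ Y_meas Y_third_moment Y_stein_discrepancy [OF assms]]
      W_law_standardized [of "Suc n"]
    by (simp add: W_next_law beta_seq_def)
qed

lemma wasserstein_le_stein_discrepancy:
  assumes "stein_discrepancy_le (W_law n) K"
  shows "wasserstein (M n) (W_seq M X n) std_normal_distribution (\<lambda>x. x) \<le> ereal (8 * K)"
  unfolding wasserstein_def
proof (rule SUP_least)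
  interpret D: standardized_law "W_law n" by (rule W_law_standardized)
  fix h :: "real \<Rightarrow> real"
  assume "h \<in> {h. \<forall>x y. \<bar>h y - h x\<bar> \<le> \<bar>y - x\<bar>}"
  then have h: "1-lipschitz_on UNIV h"
    by (auto intro!: lipschitz_onI simp: dist_real_def)
  have "(\<integral>\<omega>. h (W_seq M X n \<omega>) \<partial>M n) = (\<integral>x. h x \<partial>W_law n)"
    using W_meas [of n] lipschitz_on_borel_measurable [OF h] by (simp add: integral_distr)
  then show "ereal \<bar>(\<integral>\<omega>. h (W_seq M X n \<omega>) \<partial>M n) - (\<integral>\<omega>. h \<omega> \<partial>std_normal_distribution)\<bar> \<le> ereal (8 * K)"
    using D.lipschitz_integral_normal_diff_le [OF assms h] by simp
qed

lemma beta_seq_nonneg: "0 \<le> beta_seq \<alpha> M X V Z n"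
  by (simp add: beta_seq_def)

text \<open>The sequence \<open>K\<close> starts with the finite discrepancy of \<open>W\<^sub>0\<close> and follows the recursion with equality.\<close>

lemma normal_rate_of_recursion:
  assumes beta: "eventually (\<lambda>n. beta_seq \<alpha> M X V Z n \<le> B * \<gamma> ^ n) sequentially"
    and phi: "eventually (\<lambda>n. phi_vec (\<alpha> n) \<le> \<psi>) sequentially"
    and "0 < \<gamma>" "0 \<le> \<psi>" "\<psi> < \<gamma>"
  shows "normal_rate M X \<gamma>"
proof -
  define K where "K = rec_nat ((\<integral>x. \<bar>x\<bar> \<partial>W_law 0) + 1 / 2 * (\<integral>x. \<bar>x\<bar> ^ 3 \<partial>W_law 0))
    (\<lambda>n k. beta_seq \<alpha> M X V Z n + phi_vec (\<alpha> n) * k)"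
  have K_Suc: "K (Suc n) = beta_seq \<alpha> M X V Z n + phi_vec (\<alpha> n) * K n" for n
    by (simp add: K_def)
  have K_nonneg: "0 \<le> K n" for n
    by (induction n) (simp_all add: K_def beta_seq_nonneg phi_vec_nonneg)
  have disc: "stein_discrepancy_le (W_law n) (K n)" for n
  proof (induction n)
    case 0
    interpret D: standardized_law "W_law 0" by (rule W_law_standardized)
    show ?case
      using D.stein_discrepancy_finite by (simp add: K_def)
  next
    case (Suc n)
    then show ?case
      unfolding K_Suc by (rule W_stein_discrepancy_step)
  qed
  obtain C where C: "\<And>n. K n \<le> C * \<gamma> ^ n"
    by (rule geometric_bound_of_recursion [where K = K, OF _ _ beta phi assms(3-5)])
      (auto simp: K_Suc K_nonneg)
  have "wasserstein (M n) (W_seq M X n) std_normal_distribution (\<lambda>x. x) \<le> ereal (8 * C * \<gamma> ^ n)" for n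
    by (rule order_trans [OF wasserstein_le_stein_discrepancy [OF disc [of n]]])
       (use C [of n] in \<open>simp add: mult.assoc\<close>)
  then show ?thesis
    unfolding normal_rate_def by blast
qed

end

text \<open>A factor \<open>\<psi>\<close> strictly between \<open>\<phi>\<close> and \<open>\<gamma>\<close> eventually dominates \<open>\<phi>\<^sub>n\<close>. The case \<open>\<gamma> = \<beta>\<close> is the first
alternative of the theorem, the case \<open>\<beta> \<le> \<phi> < \<gamma>\<close> the second.\<close>

lemma normal_rate_of_limsup:
  assumes third: "\<And>n. integrable (M n) (\<lambda>\<omega>. \<bar>X n \<omega>\<bar> ^ 3)"
    and "0 < \<beta>" "0 < \<phi>"
    and beta: "limsup (\<lambda>n. ereal (beta_seq \<alpha> M X V Z n / \<beta> ^ n)) < \<infinity>"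
    and phi: "limsup (\<lambda>n. ereal (phi_vec (\<alpha> n))) = ereal \<phi>"
    and "\<beta> \<le> \<gamma>" "\<phi> < \<gamma>"
  shows "normal_rate M X \<gamma>"
proof -
  obtain \<psi> where \<psi>: "\<phi> < \<psi>" "\<psi> < \<gamma>"
    using dense [OF \<open>\<phi> < \<gamma>\<close>] by blast
  obtain B where B: "limsup (\<lambda>n. ereal (beta_seq \<alpha> M X V Z n / \<beta> ^ n)) < ereal B"
    using beta less_PInf_Ex_of_nat [of "limsup (\<lambda>n. ereal (beta_seq \<alpha> M X V Z n / \<beta> ^ n))"] by auto
  from Limsup_lessD [OF B] have ev: "eventually (\<lambda>n. beta_seq \<alpha> M X V Z n \<le> \<bar>B\<bar> * \<gamma> ^ n) sequentially"
  proof (rule eventually_mono)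
    fix n
    assume "ereal (beta_seq \<alpha> M X V Z n / \<beta> ^ n) < ereal B"
    then have "beta_seq \<alpha> M X V Z n \<le> B * \<beta> ^ n"
      using \<open>0 < \<beta>\<close> by (simp add: field_simps)
    also have "\<dots> \<le> \<bar>B\<bar> * \<gamma> ^ n"
      using \<open>0 < \<beta>\<close> \<open>\<beta> \<le> \<gamma>\<close> by (intro mult_mono power_mono) auto
    finally show "beta_seq \<alpha> M X V Z n \<le> \<bar>B\<bar> * \<gamma> ^ n" .
  qed
  have "eventually (\<lambda>n. phi_vec (\<alpha> n) \<le> \<psi>) sequentially"
    using Limsup_lessD [of sequentially "\<lambda>n. ereal (phi_vec (\<alpha> n))" "ereal \<psi>"] phi \<psi>(1)
    by (auto elim: eventually_mono)
  from normal_rate_of_recursion [OF third ev this] show ?thesis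
    using \<psi> \<open>0 < \<phi>\<close> \<open>\<phi> < \<gamma>\<close> by simp
qed

lemma W_fourth_moment:
  assumes fourth: "integrable (M n) (\<lambda>\<omega>. (X n \<omega> - c n) ^ 4)"
  shows "integrable (W_law n) (\<lambda>x. x ^ 4)"
    and "(\<integral>x. x ^ 4 \<partial>W_law n) = (\<integral>\<omega>. (X n \<omega> - c n) ^ 4 \<partial>M n) / \<sigma> n ^ 4"
proof -
  have eq: "W_seq M X n \<omega> ^ 4 = (X n \<omega> - c n) ^ 4 / \<sigma> n ^ 4" for \<omega>
    by (simp add: W_seq_eq power_divide)
  show "integrable (W_law n) (\<lambda>x. x ^ 4)"
    using W_meas [of n] fourth by (subst integrable_distr_eq) (simp_all add: eq)
  show "(\<integral>x. x ^ 4 \<partial>W_law n) = (\<integral>\<omega>. (X n \<omega> - c n) ^ 4 \<partial>M n) / \<sigma> n ^ 4"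
    using W_meas [of n] by (subst integral_distr) (simp_all add: eq)
qed

lemma third_moment_if_fourth_central:
  assumes "integrable (M n) (\<lambda>\<omega>. (X n \<omega> - c n) ^ 4)"
  shows "integrable (M n) (\<lambda>\<omega>. \<bar>X n \<omega>\<bar> ^ 3)"
proof -
  interpret prob_space "M n" by (rule prob_space_M)
  have "integrable (M n) (\<lambda>\<omega>. \<bar>(X n \<omega> - c n) + c n\<bar> ^ 3)"
    using X_meas [of n] integrable_cube_if_fourth [OF _ assms]
    by (intro integrable_cube_add) auto
  then show ?thesis
    by simp
qed

text \<open>Both sides are centred: \<open>E Z\<^sub>n\<close> exists because \<open>Z\<^sub>n\<close> is the difference of two integrable variables, one of
which has the law of \<open>X\<^sub>n\<^sub>+\<^sub>1\<close>.\<close>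

lemma W_next_decomposition:
  "W_next \<alpha> M X V Z n \<omega> = norm (\<alpha> n) * \<sigma> n / \<sigma> (Suc n) * Y_seq \<alpha> M X V n \<omega>
     + (Z n \<omega> - prob_space.expectation (M n) (Z n)) / \<sigma> (Suc n)"
proof -
  interpret prob_space "M n" by (rule prob_space_M)
  have V_int: "integrable (M n) (\<lambda>\<omega>. V n \<omega> $ i)" and V_mean: "expectation (\<lambda>\<omega>. V n \<omega> $ i) = c n" for i
  proof -
    have "integrable (distr (M n) borel (\<lambda>\<omega>. V n \<omega> $ i)) (\<lambda>x. x)"
      unfolding V_law using X_meas [of n] X_integrable [of n] by (simp add: integrable_distr_eq)
    then show "integrable (M n) (\<lambda>\<omega>. V n \<omega> $ i)"
      using V_meas [of n i] by (simp add: integrable_distr_eq)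
    have "expectation (\<lambda>\<omega>. V n \<omega> $ i) = (\<integral>x. x \<partial>distr (M n) borel (\<lambda>\<omega>. V n \<omega> $ i))"
      using V_meas [of n i] by (subst integral_distr) auto
    also have "\<dots> = c n"
      unfolding V_law using X_meas [of n] by (subst integral_distr) auto
    finally show "expectation (\<lambda>\<omega>. V n \<omega> $ i) = c n" .
  qed
  have \<alpha>V_int: "integrable (M n) (\<lambda>\<omega>. \<alpha> n \<bullet> V n \<omega>)"
    unfolding inner_vec_def using V_int by simp
  have \<alpha>V_mean: "expectation (\<lambda>\<omega>. \<alpha> n \<bullet> V n \<omega>) = (\<Sum>i\<in>UNIV. \<alpha> n $ i * c n)"
    unfolding inner_vec_def using V_int by (simp add: V_mean)
  have sum_meas: "(\<lambda>\<omega>. \<alpha> n \<bullet> V n \<omega> + Z n \<omega>) \<in> borel_measurable (M n)"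
    using \<alpha>V_meas [of n] Z_meas [of n] by simp
  have "integrable (distr (M (Suc n)) borel (X (Suc n))) (\<lambda>x. x)"
    using X_meas [of "Suc n"] X_integrable [of "Suc n"] by (simp add: integrable_distr_eq)
  then have sum_int: "integrable (M n) (\<lambda>\<omega>. \<alpha> n \<bullet> V n \<omega> + Z n \<omega>)"
    unfolding X_Suc_law using sum_meas by (simp add: integrable_distr_eq)
  have Z_int: "integrable (M n) (Z n)"
    using Bochner_Integration.integrable_diff [OF sum_int \<alpha>V_int] by simp
  have "c (Suc n) = (\<integral>x. x \<partial>distr (M (Suc n)) borel (X (Suc n)))"
    using X_meas [of "Suc n"] by (subst integral_distr) auto
  also have "\<dots> = expectation (\<lambda>\<omega>. \<alpha> n \<bullet> V n \<omega> + Z n \<omega>)"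
    unfolding X_Suc_law using sum_meas by (subst integral_distr) auto
  also have "\<dots> = (\<Sum>i\<in>UNIV. \<alpha> n $ i * c n) + expectation (Z n)"
    using \<alpha>V_int Z_int by (simp add: \<alpha>V_mean)
  finally have c_Suc: "c (Suc n) = (\<Sum>i\<in>UNIV. \<alpha> n $ i * c n) + expectation (Z n)" .
  have "norm (\<alpha> n) * \<sigma> n * Y_seq \<alpha> M X V n \<omega> = (\<Sum>i\<in>UNIV. \<alpha> n $ i * (V n \<omega> $ i - c n))"
    unfolding Y_seq_eq sum_distrib_left
    using \<alpha>_nz [of n] \<sigma>_pos [of n] by (intro sum.cong) (auto simp: field_simps)
  also have "\<dots> = \<alpha> n \<bullet> V n \<omega> - (\<Sum>i\<in>UNIV. \<alpha> n $ i * c n)"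
    by (simp add: inner_vec_def right_diff_distrib sum_subtractf)
  finally have "W_next \<alpha> M X V Z n \<omega> = (norm (\<alpha> n) * \<sigma> n * Y_seq \<alpha> M X V n \<omega>
      + (Z n \<omega> - expectation (Z n))) / \<sigma> (Suc n)"
    by (simp add: W_next_def c_Suc)
  then show ?thesis
    by (simp add: add_divide_distrib)
qed

lemma beta_seq_le_of_fourth_moments:
  assumes fourth: "\<And>n. integrable (M n) (\<lambda>\<omega>. (X n \<omega> - c n) ^ 4)"
  shows "beta_seq \<alpha> M X V Z n \<le> std_dev (M n) (Z n) / \<sigma> (Suc n) * (2 + 3 / 2 *
    sqrt (2 * ((\<integral>x. x ^ 4 \<partial>W_law (Suc n)) + (real CARD('k))\<^sup>2 * (\<integral>x. x ^ 4 \<partial>W_law n))))"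
proof -
  interpret prob_space "M n" by (rule prob_space_M)
  note third = third_moment_if_fourth_central [OF fourth]
  note standardized = W_law_standardized [OF third]
  interpret S: standardized_law "W_law (Suc n)" by (rule standardized)
  let ?W = "W_next \<alpha> M X V Z n" and ?Y = "Y_seq \<alpha> M X V n"
  let ?s = "std_dev (M n) (Z n) / \<sigma> (Suc n)"
  have s: "0 \<le> ?s"
    using \<sigma>_pos [of "Suc n"] variance_positive [of "Z n"] by (simp add: std_dev_def)
  have W4: "integrable (M n) (\<lambda>\<omega>. ?W \<omega> ^ 4)"
    by (rule integrable_if_distr [OF W_next_meas W_next_law W_fourth_moment(1) [OF fourth]]) simp
  have W4_eq: "expectation (\<lambda>\<omega>. ?W \<omega> ^ 4) = (\<integral>x. x ^ 4 \<partial>W_law (Suc n))"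
    unfolding W_next_law [symmetric] using W_next_meas [of n] by (subst integral_distr) auto
  have W2: "expectation (\<lambda>\<omega>. (?W \<omega>)\<^sup>2) = 1"
    unfolding S.variance_one [symmetric] W_next_law [symmetric]
    using W_next_meas [of n] by (subst integral_distr) auto
  have Y2: "expectation (\<lambda>\<omega>. (?Y \<omega>)\<^sup>2) = 1"
  proof -
    interpret D: standardized_law "W_law n" by (rule standardized)
    have "(\<integral>x. x\<^sup>2 \<partial>distr (M n) borel ?Y) = 1"
      by (rule stein_discrepancy_le_variance_one [OF real_distribution_distr [OF Y_meas]
            Y_stein_discrepancy [OF third D.stein_discrepancy_finite]])
    then show ?thesis
      using Y_meas [of n] by (subst (asm) integral_distr) auto
  qed
  have U: "(\<lambda>\<omega>. (V n \<omega> $ i - c n) / \<sigma> n) \<in> borel_measurable (M n)" for i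
    using V_meas [of n i] by simp
  have U4: "integrable (M n) (\<lambda>\<omega>. ((V n \<omega> $ i - c n) / \<sigma> n) ^ 4)" for i
    by (rule integrable_if_distr [OF U V_standardized_law W_fourth_moment(1) [OF fourth]]) simp
  have U4_eq: "expectation (\<lambda>\<omega>. ((V n \<omega> $ i - c n) / \<sigma> n) ^ 4) = (\<integral>x. x ^ 4 \<partial>W_law n)" for i
    unfolding V_standardized_law [of n i, symmetric] using U [of i] by (subst integral_distr) auto
  note Y4 = fourth_moment_normalized_sum_le [where U = "\<lambda>i \<omega>. (V n \<omega> $ i - c n) / \<sigma> n", OF U U4 U4_eq sum_normalized_squares [OF \<alpha>_nz [of n]],
      folded Y_seq_def]
  have \<zeta>: "expectation (\<lambda>\<omega>. ((Z n \<omega> - expectation (Z n)) / \<sigma> (Suc n))\<^sup>2) = ?s\<^sup>2"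
    using variance_positive [of "Z n"] by (simp add: power_divide std_dev_def)
  have "beta_seq \<alpha> M X V Z n
      \<le> ?s * (2 + 3 / 2 * sqrt (2 * (expectation (\<lambda>\<omega>. ?W \<omega> ^ 4) + expectation (\<lambda>\<omega>. ?Y \<omega> ^ 4))))"
    unfolding beta_seq_def
    by (rule cubic_distance_of_small_perturbation
        [OF W_next_meas W4 W2 Y_meas Y4(1) Y2 W_next_decomposition _ \<zeta> s])
       (use \<sigma>_pos [of n] \<sigma>_pos [of "Suc n"] in simp)
  also have "\<dots> \<le> ?s * (2 + 3 / 2 * sqrt (2 * ((\<integral>x. x ^ 4 \<partial>W_law (Suc n))
      + (real CARD('k))\<^sup>2 * (\<integral>x. x ^ 4 \<partial>W_law n))))"
    using Y4(2) s unfolding W4_eq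
    by (intro mult_left_mono add_left_mono real_sqrt_le_mono) auto
  finally show ?thesis .
qed

text \<open>From \<open>E (W\<^sup>2 - 1)\<^sup>2 \<ge> 0\<close>.\<close>

lemma one_le_W_fourth_moment:
  assumes fourth: "\<And>n. integrable (M n) (\<lambda>\<omega>. (X n \<omega> - c n) ^ 4)"
  shows "1 \<le> (\<integral>x. x ^ 4 \<partial>W_law n)"
proof -
  interpret D: standardized_law "W_law n"
    by (rule W_law_standardized [OF third_moment_if_fourth_central [OF fourth]])
  have "0 \<le> (\<integral>x. (x\<^sup>2 - 1)\<^sup>2 \<partial>W_law n)"
    by simp
  also have "\<dots> = (\<integral>x. x ^ 4 - 2 * x\<^sup>2 + 1 \<partial>W_law n)"
    by (rule Bochner_Integration.integral_cong) (auto simp: power2_diff)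
  also have "\<dots> = (\<integral>x. x ^ 4 \<partial>W_law n) - 1"
    using W_fourth_moment(1) [OF fourth, of n] D.integrable_square D.prob_space
    by (simp add: D.variance_one)
  finally show ?thesis
    by simp
qed

text \<open>Dividing the upper bounds on the moments by the lower bound on the variance turns them into powers
of \<open>q\<close> and \<open>\<rho>\<close>, the common factor \<open>\<parallel>a\<parallel>\<^sup>n\<close> cancelling. The resulting bound of order \<open>q\<^sup>n \<rho>\<^sup>2\<^sup>n + q\<^sup>n\<close> is at
most of order \<open>(q \<rho>\<^sup>3)\<^sup>n\<close> because \<open>\<rho> \<ge> 1\<close>.\<close>

lemma beta_seq_geometric_bound:
  assumes A: "condition_A \<alpha> M X Z a \<delta>\<^sub>1 \<delta>\<^sub>2" and B: "condition_B M X Z a \<delta>\<^sub>1 \<delta>\<^sub>2 \<delta>\<^sub>3 \<delta>\<^sub>4"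
  obtains C where "\<And>n. beta_seq \<alpha> M X V Z n \<le> C * (rate_B \<delta>\<^sub>1 \<delta>\<^sub>2 \<delta>\<^sub>3 \<delta>\<^sub>4) ^ n"
    and "\<And>n. integrable (M n) (\<lambda>\<omega>. \<bar>X n \<omega>\<bar> ^ 3)"
proof -
  define \<Lambda> where "\<Lambda> = norm a"
  have "a \<noteq> 0"
    by (rule condition_A_nonzero [OF A])
  then have \<Lambda>: "0 < \<Lambda>"
    by (simp add: \<Lambda>_def)
  from A obtain CZ CX where \<delta>: "0 < \<delta>\<^sub>1" "\<delta>\<^sub>1 < \<delta>\<^sub>2" "\<delta>\<^sub>2 < 1" and CX: "0 < CX"
    and varZ: "\<And>n. prob_space.variance (M n) (Z n) \<le> CZ\<^sup>2 * \<Lambda> ^ (2 * n) * (1 - \<delta>\<^sub>2) ^ (2 * n)"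
    and varX: "\<And>n. prob_space.variance (M n) (X n) \<ge> CX\<^sup>2 * \<Lambda> ^ (2 * n) * (1 - \<delta>\<^sub>1) ^ (2 * n)"
    unfolding condition_A_def \<Lambda>_def by blast
  from B obtain DX where \<delta>\<^sub>3: "-1 < \<delta>\<^sub>3"
    and fourthX: "\<And>n. fourth_central_moment (M n) (X n)
      \<le> ennreal (DX ^ 4 * \<Lambda> ^ (4 * n) * (1 + \<delta>\<^sub>3) ^ (4 * n))"
    unfolding condition_B_def \<Lambda>_def by blast
  have pos: "0 < 1 - \<delta>\<^sub>1" "0 < 1 - \<delta>\<^sub>2" "0 < 1 + \<delta>\<^sub>3"
    using \<delta> \<delta>\<^sub>3 by auto
  have bound_nonneg: "0 \<le> DX ^ 4 * \<Lambda> ^ (4 * n) * (1 + \<delta>\<^sub>3) ^ (4 * n)" for n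
    using \<Lambda> pos by simp
  note fourth = prob_space.fourth_central_moment_bound(1) [OF prob_space_M X_meas fourthX bound_nonneg]
    and fourth_le = prob_space.fourth_central_moment_bound(2) [OF prob_space_M X_meas fourthX bound_nonneg]
  define q \<rho> A where "q = (1 - \<delta>\<^sub>2) / (1 - \<delta>\<^sub>1)" and "\<rho> = (1 + \<delta>\<^sub>3) / (1 - \<delta>\<^sub>1)" and "A = \<bar>DX\<bar> / CX"
  have q\<rho>: "0 < q" "0 < \<rho>" "0 \<le> A"
    using pos CX by (simp_all add: q_def \<rho>_def A_def)
  have \<sigma>_lower: "CX * (\<Lambda> * (1 - \<delta>\<^sub>1)) ^ n \<le> \<sigma> n" for n
  proof -
    have "(CX * (\<Lambda> * (1 - \<delta>\<^sub>1)) ^ n)\<^sup>2 \<le> (\<sigma> n)\<^sup>2"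
      unfolding \<sigma>_square by (rule order_trans [OF eq_refl [OF power_scaled_product] varX])
    then show ?thesis
      by (rule power2_le_imp_le [OF _ less_imp_le [OF \<sigma>_pos]])
  qed
  have lower_pos: "0 < CX * (\<Lambda> * (1 - \<delta>\<^sub>1)) ^ n" for n
    using CX \<Lambda> pos by simp
  have m: "(\<integral>x. x ^ 4 \<partial>W_law n) \<le> (A * \<rho> ^ n) ^ 4" for n
  proof -
    have "(\<integral>x. x ^ 4 \<partial>W_law n) = (\<integral>\<omega>. (X n \<omega> - c n) ^ 4 \<partial>M n) / \<sigma> n ^ 4"
      by (rule W_fourth_moment(2) [OF fourth])
    also have "\<dots> \<le> (DX ^ 4 * \<Lambda> ^ (4 * n) * (1 + \<delta>\<^sub>3) ^ (4 * n)) / (CX * (\<Lambda> * (1 - \<delta>\<^sub>1)) ^ n) ^ 4"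
      by (intro frac_le power_mono zero_less_power fourth_le \<sigma>_lower lower_pos bound_nonneg
          less_imp_le [OF lower_pos])
    also have "DX ^ 4 * \<Lambda> ^ (4 * n) * (1 + \<delta>\<^sub>3) ^ (4 * n) = (\<bar>DX\<bar> * (\<Lambda> * (1 + \<delta>\<^sub>3)) ^ n) ^ 4"
      by (subst power_scaled_product) simp
    also have "\<dots> / (CX * (\<Lambda> * (1 - \<delta>\<^sub>1)) ^ n) ^ 4
        = ((\<bar>DX\<bar> * (\<Lambda> * (1 + \<delta>\<^sub>3)) ^ n) / (CX * (\<Lambda> * (1 - \<delta>\<^sub>1)) ^ n)) ^ 4"
      by (simp only: power_divide)
    also have "(\<bar>DX\<bar> * (\<Lambda> * (1 + \<delta>\<^sub>3)) ^ n) / (CX * (\<Lambda> * (1 - \<delta>\<^sub>1)) ^ n) = A * \<rho> ^ n"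
      using \<Lambda> pos unfolding A_def \<rho>_def by (intro scaled_power_quotient) auto
    finally show ?thesis .
  qed
  \<comment> \<open>Otherwise the upper bound on the standardized fourth moments would tend to \<open>0\<close>.\<close>
  have \<rho>1: "1 \<le> \<rho>"
  proof (rule ccontr)
    assume "\<not> 1 \<le> \<rho>"
    with q\<rho> have "(\<lambda>n. (A * \<rho> ^ n) ^ 4) \<longlonglongrightarrow> (A * 0) ^ 4"
      by (intro tendsto_intros LIMSEQ_power_zero) auto
    then have "1 \<le> (A * 0) ^ 4"
      by (rule tendsto_lowerbound)
         (auto intro!: always_eventually order_trans [OF one_le_W_fourth_moment [OF fourth] m])
    then show False
      by simp
  qed
  define E where "E = \<bar>CZ\<bar> / (CX * (\<Lambda> * (1 - \<delta>\<^sub>1)))"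
  define R where "R = sqrt (2 * (\<rho> ^ 4 + (real CARD('k))\<^sup>2))"
  have E: "0 \<le> E" and R: "0 \<le> R"
    using CX \<Lambda> pos by (simp_all add: E_def R_def)
  have s: "std_dev (M n) (Z n) / \<sigma> (Suc n) \<le> E * q ^ n" for n
  proof -
    interpret prob_space "M n" by (rule prob_space_M)
    have "std_dev (M n) (Z n) \<le> \<bar>CZ\<bar> * (\<Lambda> * (1 - \<delta>\<^sub>2)) ^ n"
      unfolding std_dev_def
    proof (rule real_le_lsqrt)
      show "variance (Z n) \<le> (\<bar>CZ\<bar> * (\<Lambda> * (1 - \<delta>\<^sub>2)) ^ n)\<^sup>2"
        using varZ [of n] by (subst power_scaled_product) simp
    qed (use variance_positive [of "Z n"] \<Lambda> pos in auto)
    then have "std_dev (M n) (Z n) / \<sigma> (Suc n)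
        \<le> (\<bar>CZ\<bar> * (\<Lambda> * (1 - \<delta>\<^sub>2)) ^ n) / (CX * (\<Lambda> * (1 - \<delta>\<^sub>1)) ^ Suc n)"
      using \<Lambda> pos by (intro frac_le \<sigma>_lower lower_pos) auto
    also have "CX * (\<Lambda> * (1 - \<delta>\<^sub>1)) ^ Suc n = CX * (\<Lambda> * (1 - \<delta>\<^sub>1)) * (\<Lambda> * (1 - \<delta>\<^sub>1)) ^ n"
      by (simp only: power_Suc mult.assoc)
    also have "(\<bar>CZ\<bar> * (\<Lambda> * (1 - \<delta>\<^sub>2)) ^ n) / \<dots> = E * q ^ n"
      using \<Lambda> pos unfolding E_def q_def by (intro scaled_power_quotient) auto
    finally show ?thesis .
  qed
  have beta: "beta_seq \<alpha> M X V Z n \<le> E * (2 + 3 / 2 * (A\<^sup>2 * R)) * (q * \<rho> ^ 3) ^ n" for n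
  proof -
    let ?m = "(\<integral>x. x ^ 4 \<partial>W_law (Suc n)) + (real CARD('k))\<^sup>2 * (\<integral>x. x ^ 4 \<partial>W_law n)"
    have "?m \<le> (A * \<rho> ^ Suc n) ^ 4 + (real CARD('k))\<^sup>2 * (A * \<rho> ^ n) ^ 4"
      by (intro add_mono mult_left_mono m) auto
    also have "\<dots> = (A * \<rho> ^ n) ^ 4 * (\<rho> ^ 4 + (real CARD('k))\<^sup>2)"
      by (simp add: power_mult_distrib algebra_simps)
    finally have "sqrt (2 * ?m) \<le> sqrt (((A * \<rho> ^ n)\<^sup>2)\<^sup>2 * (2 * (\<rho> ^ 4 + (real CARD('k))\<^sup>2)))"
      by (intro real_sqrt_le_mono) (simp add: algebra_simps)
    also have "\<dots> = (A * \<rho> ^ n)\<^sup>2 * R"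
      by (simp only: real_sqrt_mult real_sqrt_abs abs_power2 R_def)
    finally have sq: "sqrt (2 * ?m) \<le> (A * \<rho> ^ n)\<^sup>2 * R" .
    have \<rho>n: "1 \<le> \<rho> ^ n"
      using \<rho>1 by simp
    have "2 + 3 / 2 * sqrt (2 * ?m) \<le> 2 * (\<rho> ^ n) ^ 3 + 3 / 2 * (A\<^sup>2 * R * (\<rho> ^ n) ^ 3)"
    proof (intro add_mono mult_left_mono)
      show "2 \<le> 2 * (\<rho> ^ n) ^ 3"
        using one_le_power [OF \<rho>n, of 3] by simp
      have "(\<rho> ^ n)\<^sup>2 \<le> (\<rho> ^ n) ^ 3"
        using \<rho>n by (intro power_increasing) auto
      then have "A\<^sup>2 * R * (\<rho> ^ n)\<^sup>2 \<le> A\<^sup>2 * R * (\<rho> ^ n) ^ 3"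
        using R by (intro mult_left_mono) auto
      with sq show "sqrt (2 * ?m) \<le> A\<^sup>2 * R * (\<rho> ^ n) ^ 3"
        by (simp add: power_mult_distrib mult_ac)
    qed simp
    then have "2 + 3 / 2 * sqrt (2 * ?m) \<le> (2 + 3 / 2 * (A\<^sup>2 * R)) * (\<rho> ^ n) ^ 3"
      by (simp add: algebra_simps)
    moreover have "0 \<le> 2 + 3 / 2 * sqrt (2 * ?m)"
      using one_le_W_fourth_moment [OF fourth, of n] one_le_W_fourth_moment [OF fourth, of "Suc n"]
      by simp
    ultimately have "std_dev (M n) (Z n) / \<sigma> (Suc n) * (2 + 3 / 2 * sqrt (2 * ?m))
        \<le> E * q ^ n * ((2 + 3 / 2 * (A\<^sup>2 * R)) * (\<rho> ^ n) ^ 3)"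
      using s [of n] E q\<rho> by (intro mult_mono) auto
    also have "\<dots> = E * (2 + 3 / 2 * (A\<^sup>2 * R)) * (q * \<rho> ^ 3) ^ n"
      by (simp add: power_mult_distrib mult_ac flip: power_mult)
    finally show ?thesis
      using beta_seq_le_of_fourth_moments [OF fourth, of n] by linarith
  qed
  have rate: "q * \<rho> ^ 3 \<le> rate_B \<delta>\<^sub>1 \<delta>\<^sub>2 \<delta>\<^sub>3 \<delta>\<^sub>4"
  proof -
    have "q * \<rho> ^ 3 = (1 - \<delta>\<^sub>2) * (1 + \<delta>\<^sub>3) ^ 3 / (1 - \<delta>\<^sub>1) ^ 4"
      by (simp add: q_def \<rho>_def power_divide power3_eq_cube power4_eq_xxxx)
    then show ?thesis
      by (simp add: rate_B_def)
  qed
  show ?thesis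
  proof (rule that)
    fix n
    have "E * (2 + 3 / 2 * (A\<^sup>2 * R)) * (q * \<rho> ^ 3) ^ n
        \<le> E * (2 + 3 / 2 * (A\<^sup>2 * R)) * rate_B \<delta>\<^sub>1 \<delta>\<^sub>2 \<delta>\<^sub>3 \<delta>\<^sub>4 ^ n"
      using rate q\<rho> E R by (intro mult_left_mono power_mono) auto
    with beta [of n]
    show "beta_seq \<alpha> M X V Z n \<le> E * (2 + 3 / 2 * (A\<^sup>2 * R)) * rate_B \<delta>\<^sub>1 \<delta>\<^sub>2 \<delta>\<^sub>3 \<delta>\<^sub>4 ^ n"
      by linarith
  qed (rule third_moment_if_fourth_central [OF fourth])
qed

lemma normal_rate_of_moment_conditions:
  assumes A: "condition_A \<alpha> M X Z a \<delta>\<^sub>1 \<delta>\<^sub>2" and B: "condition_B M X Z a \<delta>\<^sub>1 \<delta>\<^sub>2 \<delta>\<^sub>3 \<delta>\<^sub>4"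
    and \<gamma>: "rate_B \<delta>\<^sub>1 \<delta>\<^sub>2 \<delta>\<^sub>3 \<delta>\<^sub>4 \<le> \<gamma>" "phi_vec a < \<gamma>"
  shows "normal_rate M X \<gamma>"
proof -
  obtain C where C: "\<And>n. beta_seq \<alpha> M X V Z n \<le> C * (rate_B \<delta>\<^sub>1 \<delta>\<^sub>2 \<delta>\<^sub>3 \<delta>\<^sub>4) ^ n"
    and third: "\<And>n. integrable (M n) (\<lambda>\<omega>. \<bar>X n \<omega>\<bar> ^ 3)"
    by (rule beta_seq_geometric_bound [OF A B]) blast
  have rate_nonneg: "0 \<le> rate_B \<delta>\<^sub>1 \<delta>\<^sub>2 \<delta>\<^sub>3 \<delta>\<^sub>4"
    by (simp add: rate_B_def le_max_iff_disj)
  have "beta_seq \<alpha> M X V Z n \<le> \<bar>C\<bar> * \<gamma> ^ n" for n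
  proof -
    have "C * (rate_B \<delta>\<^sub>1 \<delta>\<^sub>2 \<delta>\<^sub>3 \<delta>\<^sub>4) ^ n \<le> \<bar>C\<bar> * \<gamma> ^ n"
      using rate_nonneg \<gamma> by (intro mult_mono power_mono) auto
    with C [of n] show ?thesis
      by linarith
  qed
  then have ev: "eventually (\<lambda>n. beta_seq \<alpha> M X V Z n \<le> \<bar>C\<bar> * \<gamma> ^ n) sequentially"
    by simp
  obtain \<psi> where \<psi>: "phi_vec a < \<psi>" "\<psi> < \<gamma>"
    using dense [OF \<gamma>(2)] by blast
  have "\<alpha> \<longlonglongrightarrow> a"
    using A by (simp add: condition_A_def)
  then have "eventually (\<lambda>n. phi_vec (\<alpha> n) < \<psi>) sequentially"
    by (rule order_tendstoD(2) [OF tendsto_phi_vec [OF _ condition_A_nonzero [OF A]] \<psi>(1)])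
  then have "eventually (\<lambda>n. phi_vec (\<alpha> n) \<le> \<psi>) sequentially"
    by (rule eventually_mono) simp
  from normal_rate_of_recursion [OF third ev this] show ?thesis
    using \<psi> phi_vec_nonneg [of a] by simp
qed

end

theorem theorem3p1:
  fixes \<alpha> :: "nat \<Rightarrow> real ^ 'k"
    and M :: "nat \<Rightarrow> 'a measure"
    and X Z :: "nat \<Rightarrow> 'a \<Rightarrow> real"
    and V :: "nat \<Rightarrow> 'a \<Rightarrow> real ^ 'k"
  assumes "CARD('k) \<ge> 2"
    and "hierarchical_sequence \<alpha> M X V Z"
  shows
    "((\<forall>n. integrable (M n) (\<lambda>\<omega>. \<bar>X n \<omega>\<bar> ^ 3)) \<longrightarrow>
      (\<forall>\<beta> \<phi> :: real.
         0 < \<beta> \<and> \<beta> < 1 \<and> 0 < \<phi> \<and> \<phi> < 1 \<and>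
         limsup (\<lambda>n. ereal (beta_seq \<alpha> M X V Z n / \<beta> ^ n)) < \<infinity> \<and>
         limsup (\<lambda>n. ereal (phi_vec (\<alpha> n))) = ereal \<phi> \<longrightarrow>
         (\<phi> < \<beta> \<longrightarrow> normal_rate M X \<beta>) \<and>
         (\<beta> \<le> \<phi> \<longrightarrow> (\<forall>\<gamma>. \<phi> < \<gamma> \<and> \<gamma> < 1 \<longrightarrow> normal_rate M X \<gamma>))))
     \<and>
     (\<forall>(a :: real ^ 'k) \<delta>\<^sub>1 \<delta>\<^sub>2 \<delta>\<^sub>3 \<delta>\<^sub>4.
        condition_A \<alpha> M X Z a \<delta>\<^sub>1 \<delta>\<^sub>2 \<and> condition_B M X Z a \<delta>\<^sub>1 \<delta>\<^sub>2 \<delta>\<^sub>3 \<delta>\<^sub>4 \<longrightarrow>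
        phi_vec a < 1 \<and>
        (\<forall>\<gamma>. max (rate_B \<delta>\<^sub>1 \<delta>\<^sub>2 \<delta>\<^sub>3 \<delta>\<^sub>4) (phi_vec a) < \<gamma> \<and> \<gamma> < 1 \<longrightarrow> normal_rate M X \<gamma>))"
proof -
  interpret hierarchical \<alpha> M X V Z
    by unfold_locales (rule assms(2))
  show ?thesis
  proof (intro conjI impI allI; (elim conjE)?)
    fix \<beta> \<phi> :: real
    assume "\<forall>n. integrable (M n) (\<lambda>\<omega>. \<bar>X n \<omega>\<bar> ^ 3)" "0 < \<beta>" "0 < \<phi>"
      "limsup (\<lambda>n. ereal (beta_seq \<alpha> M X V Z n / \<beta> ^ n)) < \<infinity>"
      "limsup (\<lambda>n. ereal (phi_vec (\<alpha> n))) = ereal \<phi>"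
    note rate = normal_rate_of_limsup [OF this(1) [rule_format] this(2-)]
    show "normal_rate M X \<beta>" if "\<phi> < \<beta>"
      by (rule rate) (use that in auto)
    show "normal_rate M X \<gamma>" if "\<beta> \<le> \<phi>" "\<phi> < \<gamma>" for \<gamma>
      by (rule rate) (use that in auto)
  next
    fix a :: "real ^ 'k" and \<delta>\<^sub>1 \<delta>\<^sub>2 \<delta>\<^sub>3 \<delta>\<^sub>4 :: real
    assume A: "condition_A \<alpha> M X Z a \<delta>\<^sub>1 \<delta>\<^sub>2" and B: "condition_B M X Z a \<delta>\<^sub>1 \<delta>\<^sub>2 \<delta>\<^sub>3 \<delta>\<^sub>4"
    show "phi_vec a < 1"
      by (rule phi_vec_less_one) (use A in \<open>simp add: condition_A_def\<close>)
    show "normal_rate M X \<gamma>" if "max (rate_B \<delta>\<^sub>1 \<delta>\<^sub>2 \<delta>\<^sub>3 \<delta>\<^sub>4) (phi_vec a) < \<gamma>" for \<gamma>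
      by (rule normal_rate_of_moment_conditions [OF A B]) (use that in auto)
  qed
qed

end
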